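(* (1) For every $k\ge0$, $\operatorname{Im}\mathfrak d_k=\ker\mathfrak d_{k+1}$, and it is irreducible and isomorphic to $L(\omega_{k+1})$. (2) For every $k\ge1$, $\mathcal V(\omega_k)$ has exactly two composition factors, each with multiplicity one: $L(\omega_k)$ (the submodule $\operatorname{Im}\mathfrak d_{k-1}$) and $L(\omega_{k+1})$ (the quotient $\mathcal V(\omega_k)/\operatorname{Im}\mathfrak d_{k-1}\cong\operatorname{Im}\mathfrak d_k$).
   Context: $\mathbb F$ algebraically closed of characteristic $0$, $m,n\ge1$. $\mathcal R=\mathbb F[x_1,\dots,x_m]\otimes\Lambda(y_1,\dots,y_n)$ ($x_i$ even, $y_s$ odd). $\mathfrak g=W(m,n)$ the Lie superalgebra of superderivations of $\mathcal R$, free over $\mathcal R$ on even $\partial_i$ and odd $D_t$, with $\mathfrak g_0\cong\mathfrak{gl}(m|n)$ via $x_i\partial_j\mapsto E_{ij}$, $x_iD_s\mapsto E_{i,m+s}$, $y_r\partial_j\mapsto E_{m+r,j}$, $y_rD_s\mapsto E_{m+r,m+s}$. For dominant integral $\lambda$, $L^0(\lambda)$ is the irreducible finite-dimensional $\mathfrak g_0$-module of highest weight $\lambda$, $\mathcal V(\lambda)=\mathcal R\otimes L^0(\lambda)$ the mixed-product module (action for homogeneous $f,g$, $\xi$ the $\mathfrak g_0$-action: $f\partial_i.(g\otimes v)=f\partial_i(g)\otimes v+\sum_j\partial_j(f)g\otimes\xi(x_j\partial_i)v+(-1)^{\wp(f)+\wp(g)+1}\sum_jD_j(f)g\otimes\xi(y_j\partial_i)v$,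 $fD_i.(g\otimes v)=fD_i(g)\otimes v+(-1)^{\wp(g)}\sum_j\partial_j(f)g\otimes\xi(x_jD_i)v+(-1)^{\wp(f)+1}\sum_jD_j(f)g\otimes\xi(y_jD_i)v$), and $L(\lambda)$ the unique simple submodule $U(\mathfrak g)(1\otimes L^0(\lambda))$ of $\mathcal V(\lambda)$. $\omega_k=\epsilon_1+\dots+\epsilon_k$ for $k\le m$, $\omega_k=\epsilon_1+\dots+\epsilon_m+(k-m)\delta_1$ for $k\ge m$, with $L^0(\omega_k)$ realized as the $k$-th super-Grassmann power $\Omega^k(V)$ of the natural module $V=\mathbb F^{m|n}$ (basis $e_i$, even iff $i\le m$, product $\curlywedge$). $\mathfrak d_k:\mathcal V(\omega_k)\to\mathcal V(\omega_{k+1})$ is the module map $\mathfrak d_k(x^\alpha y_\eta\otimes w)=\sum_{i=1}^m\partial_i(x^\alpha)y_\eta\otimes(w\curlywedge e_i)+(-1)^{\wp(w)+|\eta|+1}\sum_{i=1}^nx^\alpha D_i(y_\eta)\otimes(w\curlywedge e_{m+i})$ for basis monomials $w$ of $\Omega^k(V)$. *)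

theory Defs
  imports "HOL-Computational_Algebra.Polynomial"
begin

text \<open>
Conventions (0-based indices).  Even variables x_i (i < m), odd variables y_s (s < n).
A monomial x^alpha y_eta of R is a pair (alpha, eta) with eta a finite set of odd
indices; y_eta denotes the product of the y_s, s in eta, in increasing order.
The natural module V = F^(m|n) has basis e_c (c < m+n), e_c even iff c < m.
A basis monomial of the super-Grassmann power Omega^k(V) is a sorted list w of length k
of indices < m+n in which even indices occur at most once; it stands for the product
e_(w!0) wedge ... wedge e_(w!(k-1)).  Super-Grassmann relations:
a wedge b = -(-1)^(p(a)p(b)) b wedge a.
Vectors of the mixed product module R (x) Omega^k(V) are finitely supported
functions on pairs (R-monomial, Omega-monomial).
\<close>

type_synonym rmon = "(nat \<Rightarrow> nat) \<times> nat set"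
type_synonym bas = "rmon \<times> nat list"
type_synonym 'a vec = "bas \<Rightarrow> 'a"

definition sgn :: "bool \<Rightarrow> 'a::ring_1" where
  "sgn b = (if b then -1 else 1)"

definition valid_rmon :: "nat \<Rightarrow> nat \<Rightarrow> rmon \<Rightarrow> bool" where
  "valid_rmon m n g \<longleftrightarrow> (\<forall>i\<ge>m. fst g i = 0) \<and> snd g \<subseteq> {..<n}"

definition valid_om :: "nat \<Rightarrow> nat \<Rightarrow> nat \<Rightarrow> nat list \<Rightarrow> bool" where
  "valid_om m n k w \<longleftrightarrow> length w = k \<and> sorted w \<and> set w \<subseteq> {..<m+n}
      \<and> distinct (filter (\<lambda>c. c < m) w)"

definition rpar :: "rmon \<Rightarrow> bool" where
  "rpar g \<longleftrightarrow> odd (card (snd g))"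

definition opar :: "nat \<Rightarrow> nat list \<Rightarrow> bool" where
  "opar m w \<longleftrightarrow> odd (length (filter (\<lambda>c. m \<le> c) w))"

definition bpar :: "nat \<Rightarrow> bas \<Rightarrow> bool" where
  "bpar m b \<longleftrightarrow> (rpar (fst b) \<noteq> opar m (snd b))"

definition rmul :: "rmon \<Rightarrow> rmon \<Rightarrow> 'a::ring_1 \<times> rmon" where
  "rmul f g = ((if snd f \<inter> snd g = {} then
                 (-1) ^ card {(a,b). a \<in> snd f \<and> b \<in> snd g \<and> b < a} else 0),
               ((\<lambda>i. fst f i + fst g i), snd f \<union> snd g))"

definition rdx :: "nat \<Rightarrow> rmon \<Rightarrow> 'a::ring_1 \<times> rmon" where
  "rdx i g = (of_nat (fst g i), ((fst g)(i := fst g i - 1), snd g))"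

definition rdy :: "nat \<Rightarrow> rmon \<Rightarrow> 'a::ring_1 \<times> rmon" where
  "rdy s g = (if s \<in> snd g then (-1) ^ card {a \<in> snd g. a < s} else 0, (fst g, snd g - {s}))"

text \<open>right multiplication of a basis monomial of Omega(V) by e_c, in normal form\<close>
definition owedge :: "nat \<Rightarrow> nat list \<Rightarrow> nat \<Rightarrow> 'a::ring_1 \<times> nat list" where
  "owedge m w c = (if c < m \<and> c \<in> set w then (0, w) else
     (prod_list (map (\<lambda>d. if m \<le> c \<and> m \<le> d then 1 else -1) (filter (\<lambda>d. c < d) w)),
      insort c w))"

definition oprod :: "nat \<Rightarrow> nat list \<Rightarrow> 'a::ring_1 \<times> nat list" where
  "oprod m cs = fold (\<lambda>c sw. (fst sw * fst (owedge m (snd sw) c), snd (owedge m (snd sw) c :: 'a \<times> nat list))) cs (1, [])"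

text \<open>gl(m|n)-action xi(E_ab) on Omega(V): coefficient of basis monomial u in E_ab . w,
  where E_ab e_c = delta_bc e_a is extended as a superderivation\<close>
definition xi :: "nat \<Rightarrow> nat \<Rightarrow> nat \<Rightarrow> nat list \<Rightarrow> nat list \<Rightarrow> 'a::ring_1" where
  "xi m a b w u = (\<Sum>j<length w.
      if w ! j = b \<and> snd (oprod m (w[j := a]) :: 'a \<times> nat list) = u then
        sgn (((m \<le> a) \<noteq> (m \<le> b)) \<and> opar m (take j w)) * fst (oprod m (w[j := a]))
      else 0)"

text \<open>vector fields f d/dx_i  (f, False, i)  and  f D_i  (f, True, i), f a monomial\<close>
type_synonym vf = "rmon \<times> bool \<times> nat"

definition valid_vf :: "nat \<Rightarrow> nat \<Rightarrow> vf \<Rightarrow> bool" where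
  "valid_vf m n X \<longleftrightarrow> valid_rmon m n (fst X) \<and> (if fst (snd X) then snd (snd X) < n else snd (snd X) < m)"

text \<open>coefficient of basis element (g', w') in X.(g (x) w), following the mixed-product formulas\<close>
definition actb :: "nat \<Rightarrow> nat \<Rightarrow> vf \<Rightarrow> bas \<Rightarrow> bas \<Rightarrow> 'a::ring_1" where
  "actb m n X b b' = (let f = fst X; isD = fst (snd X); i = snd (snd X); g = fst b; w = snd b;
      g' = fst b'; w' = snd b';
      t1 = (let dg = (if isD then rdy i g else rdx i g) :: 'a \<times> rmon;
                 p = rmul f (snd dg) :: 'a \<times> rmon
             in if snd p = g' \<and> w = w' then fst dg * fst p else 0);
      t2 = (\<Sum>j<m. let df = rdx j f :: 'a \<times> rmon; p = rmul (snd df) g :: 'a \<times> rmon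
             in if snd p = g' then fst df * fst p * xi m j (if isD then m + i else i) w w' else 0);
      t3 = (\<Sum>j<n. let df = rdy j f :: 'a \<times> rmon; p = rmul (snd df) g :: 'a \<times> rmon
             in if snd p = g' then fst df * fst p * xi m (m + j) (if isD then m + i else i) w w' else 0)
   in if isD then t1 + sgn (rpar g) * t2 + sgn (\<not> rpar f) * t3
      else t1 + t2 + sgn (rpar f = rpar g) * t3)"

definition lext :: "(bas \<Rightarrow> bas \<Rightarrow> 'a::ring_1) \<Rightarrow> 'a vec \<Rightarrow> 'a vec" where
  "lext F v = (\<lambda>b'. \<Sum>b\<in>{b. v b \<noteq> 0}. v b * F b b')"

definition actv :: "nat \<Rightarrow> nat \<Rightarrow> vf \<Rightarrow> 'a::ring_1 vec \<Rightarrow> 'a vec" where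
  "actv m n X = lext (actb m n X)"

definition Vmod :: "nat \<Rightarrow> nat \<Rightarrow> nat \<Rightarrow> 'a::ring_1 vec set" where
  "Vmod m n k = {v. finite {b. v b \<noteq> 0} \<and>
      (\<forall>b. v b \<noteq> 0 \<longrightarrow> valid_rmon m n (fst b) \<and> valid_om m n k (snd b))}"

definition evpart :: "nat \<Rightarrow> 'a::ring_1 vec \<Rightarrow> 'a vec" where
  "evpart m u = (\<lambda>b. if bpar m b then 0 else u b)"

text \<open>g-submodules (Z_2-graded subspaces stable under all of W(m,n), which is spanned by
  the monomial vector fields)\<close>
definition submod :: "nat \<Rightarrow> nat \<Rightarrow> nat \<Rightarrow> 'a::ring_1 vec set \<Rightarrow> bool" where
  "submod m n k S \<longleftrightarrow> S \<subseteq> Vmod m n k \<and> (\<lambda>_. 0) \<in> S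
     \<and> (\<forall>u\<in>S. \<forall>v\<in>S. (\<lambda>b. u b + v b) \<in> S) \<and> (\<forall>c. \<forall>u\<in>S. (\<lambda>b. c * u b) \<in> S)
     \<and> (\<forall>u\<in>S. evpart m u \<in> S)
     \<and> (\<forall>X. \<forall>u\<in>S. valid_vf m n X \<longrightarrow> actv m n X u \<in> S)"

definition simple_sub :: "nat \<Rightarrow> nat \<Rightarrow> nat \<Rightarrow> 'a::ring_1 vec set \<Rightarrow> bool" where
  "simple_sub m n k S \<longleftrightarrow> submod m n k S \<and> S \<noteq> {\<lambda>_. 0}
     \<and> (\<forall>T. submod m n k T \<and> T \<subseteq> S \<longrightarrow> T = {\<lambda>_. 0} \<or> T = S)"

text \<open>L(omega_k) = U(g)(1 (x) L^0(omega_k)): the smallest submodule containing 1 (x) Omega^k(V)\<close>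
definition Lmod :: "nat \<Rightarrow> nat \<Rightarrow> nat \<Rightarrow> 'a::ring_1 vec set" where
  "Lmod m n k = \<Inter>{S. submod m n k S \<and>
      {v \<in> Vmod m n k. \<forall>b. v b \<noteq> 0 \<longrightarrow> fst b = ((\<lambda>_. 0), {})} \<subseteq> S}"

definition modhom :: "nat \<Rightarrow> nat \<Rightarrow> 'a::ring_1 vec set \<Rightarrow> ('a vec \<Rightarrow> 'a vec) \<Rightarrow> bool" where
  "modhom m n S \<phi> \<longleftrightarrow>
     (\<forall>u\<in>S. \<forall>v\<in>S. \<phi> (\<lambda>b. u b + v b) = (\<lambda>b. \<phi> u b + \<phi> v b))
   \<and> (\<forall>c. \<forall>u\<in>S. \<phi> (\<lambda>b. c * u b) = (\<lambda>b. c * \<phi> u b))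
   \<and> (\<forall>u\<in>S. \<phi> (evpart m u) = evpart m (\<phi> u))
   \<and> (\<forall>X. \<forall>u\<in>S. valid_vf m n X \<longrightarrow> \<phi> (actv m n X u) = actv m n X (\<phi> u))"

definition factor_iso :: "nat \<Rightarrow> nat \<Rightarrow> 'a::ring_1 vec set \<Rightarrow> 'a vec set \<Rightarrow> 'a vec set \<Rightarrow> bool" where
  "factor_iso m n N M L \<longleftrightarrow> (\<exists>\<phi>. modhom m n M \<phi> \<and> \<phi> ` M = L \<and>
      (\<forall>u\<in>M. \<phi> u = (\<lambda>_. 0) \<longleftrightarrow> u \<in> N))"

definition mod_iso :: "nat \<Rightarrow> nat \<Rightarrow> 'a::ring_1 vec set \<Rightarrow> 'a vec set \<Rightarrow> bool" where
  "mod_iso m n M L \<longleftrightarrow> factor_iso m n {\<lambda>_. 0} M L"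

definition comp_series :: "nat \<Rightarrow> nat \<Rightarrow> nat \<Rightarrow> 'a::ring_1 vec set list \<Rightarrow> bool" where
  "comp_series m n k Ms \<longleftrightarrow> Ms \<noteq> [] \<and> hd Ms = {\<lambda>_. 0} \<and> last Ms = Vmod m n k
     \<and> (\<forall>i<length Ms. submod m n k (Ms ! i))
     \<and> (\<forall>i. Suc i < length Ms \<longrightarrow> Ms ! i \<subset> Ms ! Suc i \<and>
          (\<forall>T. submod m n k T \<and> Ms ! i \<subseteq> T \<and> T \<subseteq> Ms ! Suc i \<longrightarrow> T = Ms ! i \<or> T = Ms ! Suc i))"

definition ddb :: "nat \<Rightarrow> nat \<Rightarrow> bas \<Rightarrow> bas \<Rightarrow> 'a::ring_1" where
  "ddb m n b b' = (let g = fst b; w = snd b in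
     (\<Sum>i<m. let dg = rdx i g :: 'a \<times> rmon; ew = owedge m w i :: 'a \<times> nat list
             in if (snd dg, snd ew) = b' then fst dg * fst ew else 0)
   + sgn (opar m w = rpar g) *
     (\<Sum>i<n. let dg = rdy i g :: 'a \<times> rmon; ew = owedge m w (m + i) :: 'a \<times> nat list
             in if (snd dg, snd ew) = b' then fst dg * fst ew else 0))"

definition dd :: "nat \<Rightarrow> nat \<Rightarrow> 'a::ring_1 vec \<Rightarrow> 'a vec" where
  "dd m n = lext (ddb m n)"

definition alg_closed_ty :: "'a::field itself \<Rightarrow> bool" where
  "alg_closed_ty _ \<longleftrightarrow> (\<forall>p :: 'a poly. degree p \<ge> 1 \<longrightarrow> (\<exists>x. poly p x = 0))"

end

theory Submission
  imports Defs "HOL-Library.Multiset"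
begin

text \<open>
The mixed-product modules form a de Rham complex, with \<open>W(m,n)\<close> acting by Lie derivatives.
For \<open>X = f \<partial>\<^sub>a\<close> put \<open>\<iota>\<^sub>X(g \<otimes> w) = \<plusminus> f g \<otimes> \<iota>\<^sub>a w\<close>; then the Cartan formula
\<open>X = d \<iota>\<^sub>X + \<iota>\<^sub>X d\<close> holds for all \<open>X\<close>, even or odd. With \<open>d\<^sup>2 = 0\<close> it shows that \<open>d\<close>
is a module map; applied to the Euler field it yields the Poincare lemma; applied to constant forms
it shows that \<open>1 \<otimes> \<Omega>\<^sup>k\<^sup>+\<^sup>1(V)\<close> generates the image of \<open>d\<close>. A nonzero submodule contains
all constant forms: differentiate down to a constant form, separate weights by the torus, and use
that \<open>gl(m|n)\<close> acts transitively on the basis monomials of \<open>\<Omega>\<^sup>k(V)\<close>. Hence the image of \<open>d\<close>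
is simple, and it is the only proper nonzero submodule. Finally \<open>L(\<omega>\<^sub>k)\<close> and \<open>L(\<omega>\<^sub>k\<^sub>+\<^sub>1)\<close> differ in
the torus weights on the vectors killed by all \<open>\<partial>\<^sub>a\<close>.

Indices \<open>a < m + n\<close> below treat even and odd variables together: \<open>\<partial>\<^sub>a\<close> is \<open>\<partial>/\<partial>x\<^sub>a\<close> for \<open>a < m\<close>
and \<open>D\<^sub>a\<^sub>-\<^sub>m\<close> otherwise.
\<close>

section \<open>Wedge and contraction operators on \<open>\<Omega>(V)\<close>\<close>

text \<open>Scaled basis vectors let identities between signed monomials be stated pointwise: when
  the coefficient is 0, the monomials on the two sides need not agree.\<close>

definition single :: "'a::zero \<Rightarrow> 'b \<Rightarrow> 'b \<Rightarrow> 'a" where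
  "single c b b' = (if b = b' then c else 0)"

lemma single_zero [simp]: "single 0 b b' = 0"
  by (simp add: single_def)

lemma single_mult_left: "x * single c b b' = single (x * c) b (b' :: 'b) " for x :: "'a::mult_zero"
  by (simp add: single_def)

lemma single_Pair: "single (x * y) (r, w) (r', w') = single x r r' * single (y :: 'a::mult_zero) w w'"
  by (auto simp: single_def)

text \<open>The hypothesis is an identity of formal combinations of basis elements; pairing both
  sides with \<open>H\<close> over a finite set containing all indices carries it through any linear
  map given on the basis.\<close>

lemma sum_single_transfer:
  fixes c :: "'i \<Rightarrow> 'a::comm_ring_1"
  assumes "finite A" "\<And>v. (\<Sum>j\<in>A. single (c j) (\<beta> j) v) = single C B v"
  shows "(\<Sum>j\<in>A. c j * H (\<beta> j)) = C * H B"
proof -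
  let ?V = "insert B (\<beta> ` A)"
  have fin: "finite ?V" using assms by simp
  have "(\<Sum>j\<in>A. c j * H (\<beta> j)) = (\<Sum>j\<in>A. \<Sum>v\<in>?V. single (c j) (\<beta> j) v * H v)"
  proof (rule sum.cong)
    fix j assume "j \<in> A"
    then have "(\<Sum>v\<in>?V. single (c j) (\<beta> j) v * H v) = (\<Sum>v\<in>?V. if \<beta> j = v then c j * H v else 0)"
      by (intro sum.cong) (auto simp: single_def)
    also have "\<dots> = c j * H (\<beta> j)" using fin \<open>j \<in> A\<close> by (subst sum.delta') auto
    finally show "c j * H (\<beta> j) = (\<Sum>v\<in>?V. single (c j) (\<beta> j) v * H v)" by simp
  qed simp
  also have "\<dots> = (\<Sum>v\<in>?V. (\<Sum>j\<in>A. single (c j) (\<beta> j) v) * H v)"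
    by (subst sum.swap) (simp add: sum_distrib_right)
  also have "\<dots> = (\<Sum>v\<in>?V. if B = v then C * H v else 0)"
    by (intro sum.cong) (simp_all only: assms(2), auto simp: single_def)
  also have "\<dots> = C * H B" using fin by (subst sum.delta') auto
  finally show ?thesis .
qed

lemma sum_lessThan_add: "(\<Sum>a<m + n. h a) = (\<Sum>a<m. h a) + (\<Sum>i<n. h (m + i))"
  for h :: "nat \<Rightarrow> 'a::comm_monoid_add"
  by (induction n) (simp_all add: add.assoc)

text \<open>The sign of exchanging \<open>e_a\<close> and \<open>e_c\<close> in a wedge product,
  -(-1)^(p(a)p(c)).\<close>

definition swap_sign :: "nat \<Rightarrow> nat \<Rightarrow> nat \<Rightarrow> 'a::comm_ring_1" where
  "swap_sign m a c = (if m \<le> a \<and> m \<le> c then 1 else - 1)"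

text \<open>The cost of moving \<open>e_c\<close> from the right end of a sorted product to its
  place: it passes exactly the larger entries.\<close>

definition osign :: "nat \<Rightarrow> nat \<Rightarrow> nat list \<Rightarrow> 'a::comm_ring_1" where
  "osign m c w = prod_list (map (swap_sign m c) (filter (\<lambda>d. c < d) w))"

definition ocoef :: "nat \<Rightarrow> nat list \<Rightarrow> nat \<Rightarrow> 'a::comm_ring_1" where
  "ocoef m w c = (if c < m \<and> c \<in> set w then 0 else osign m c w)"

text \<open>The contraction \<open>\<iota>\<^sub>b\<close> moves one factor \<open>e\<^sub>b\<close> to the right end and deletes it; all
  occurrences of an odd \<open>b\<close> contribute equally, which gives the multiplicity factor.\<close>

definition icoef :: "nat \<Rightarrow> nat \<Rightarrow> nat list \<Rightarrow> 'a::comm_ring_1" where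
  "icoef m b w = of_nat (count (mset w) b) * osign m b w"

definition om_ok :: "nat \<Rightarrow> nat list \<Rightarrow> bool" where
  "om_ok m w \<longleftrightarrow> sorted w \<and> distinct (filter (\<lambda>c. c < m) w)"

lemma swap_sign_square [simp]: "swap_sign m a b * swap_sign m a b = (1::'a::comm_ring_1)"
  by (simp add: swap_sign_def)

lemma swap_sign_sym: "swap_sign m a b = swap_sign m b a"
  by (auto simp: swap_sign_def)

lemma osign_square [simp]: "osign m b w * osign m b w = (1::'a::comm_ring_1)"
proof (induction w)
  case Nil
  then show ?case by (simp add: osign_def)
next
  case (Cons a w)
  then show ?case by (simp add: osign_def mult.assoc mult.left_commute[of "swap_sign m b a" "prod_list _"])
    (metis (no_types, lifting) mult.assoc mult_1 swap_sign_square)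
qed

lemma osign_square' [simp]: "osign m b w * (osign m b w * x) = (x::'a::comm_ring_1)"
  by (metis mult.assoc mult_1 osign_square)

lemma swap_sign_square' [simp]: "swap_sign m a b * (swap_sign m a b * x) = (x::'a::comm_ring_1)"
  by (metis mult.assoc mult_1 swap_sign_square)

lemma osign_nonzero [simp]: "osign m b w \<noteq> (0::'a::comm_ring_1)"
  by (metis mult_zero_left osign_square zero_neq_one)

lemma osign_insort: "osign m c (insort d w) = osign m c w * (if c < d then swap_sign m c d else 1)"
  by (induction w) (auto simp: osign_def mult_ac)

lemma osign_remove1: "b \<in> set w \<Longrightarrow>
    osign m c w = osign m c (remove1 b w) * (if c < b then swap_sign m c b else 1)"
  by (induction w) (auto simp: osign_def mult_ac)

lemma osign_remove1': "b \<in> set w \<Longrightarrow>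
    osign m c (remove1 b w) = osign m c w * (if c < b then swap_sign m c b else 1)"
  by (simp add: osign_remove1[of b w] mult_ac)

lemma owedge_fst: "fst (owedge m w c) = ocoef m w c"
  by (auto simp: owedge_def ocoef_def osign_def swap_sign_def[abs_def])

lemma owedge_single: "single (x * ocoef m w c) (snd (owedge m w c :: 'a::comm_ring_1 \<times> nat list))
    = single (x * ocoef m w c) (insort c w)"
  by (auto simp: owedge_def ocoef_def)

lemma om_ok_count:
  assumes "om_ok m w" "b < m"
  shows "count (mset w) b = (if b \<in> set w then 1 else 0)"
proof -
  have "distinct (filter (\<lambda>c. c < m) w)" using assms by (simp add: om_ok_def)
  then have "count (mset (filter (\<lambda>c. c < m) w)) b = (if b \<in> set (filter (\<lambda>c. c < m) w) then 1 else 0)"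
    by (simp only: distinct_count_atmost_1)
  then show ?thesis using assms(2) by simp
qed

lemma om_ok_sorted: "om_ok m w \<Longrightarrow> sorted w"
  by (simp add: om_ok_def)

lemma om_ok_iff: "om_ok m w \<longleftrightarrow> sorted w \<and> (\<forall>b<m. count (mset w) b \<le> 1)"
proof -
  have "distinct (filter (\<lambda>c. c < m) w) \<longleftrightarrow> (\<forall>b<m. count (mset w) b \<le> 1)"
    unfolding distinct_count_atmost_1
    by (auto simp: le_Suc_eq count_eq_zero_iff Suc_le_eq split: if_splits)
  then show ?thesis by (simp add: om_ok_def)
qed

lemma om_ok_insort: "om_ok m w \<Longrightarrow> \<not> (c < m \<and> c \<in> set w) \<Longrightarrow> om_ok m (insort c w)"
  by (auto simp: om_ok_iff sorted_insort count_eq_zero_iff not_in_iff)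

lemma om_ok_remove1: "om_ok m w \<Longrightarrow> om_ok m (remove1 b w)"
  by (auto simp: om_ok_iff sorted_remove1 intro: order_trans[OF diff_le_self])

lemma sorted_eqI: "sorted u \<Longrightarrow> sorted v \<Longrightarrow> mset u = mset v \<Longrightarrow> u = (v::nat list)"
  by (metis properties_for_sort)

text \<open>Canonical relation between contraction and wedge, of Clifford type for even indices and
  of Weyl type for odd ones. For \<open>b = c\<close> odd, the wedge raises the multiplicity by one;
  for \<open>b = c\<close> even, exactly one of the two composites survives.\<close>

lemma contraction_wedge:
  assumes ok: "om_ok m w"
  shows "single (ocoef m w c * icoef m b (insort c w)) (remove1 b (insort c w)) u
     = (if b = c then single 1 w u else 0)
       + swap_sign m b c * single (icoef m b w * ocoef m (remove1 b w) c) (insort c (remove1 b w)) (u :: nat list)"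
proof -
  note srt = om_ok_sorted[OF ok]
  consider (eq) "b = c" | (out) "b \<noteq> c" "b \<notin> set w" | (ins) "b \<noteq> c" "b \<in> set w" by blast
  then show ?thesis
  proof cases
    case eq
    have l: "remove1 b (insort c w) = w" using eq by simp
    show ?thesis
    proof (cases "b \<in> set w")
      case True
      have r: "insort c (remove1 b w) = w" using eq True srt
        by (intro sorted_eqI) (auto simp: sorted_insort sorted_remove1)
      have cnt: "b \<notin> set (remove1 b w)" if "b < m"
        using om_ok_count[OF ok that] True
        by (metis One_nat_def count_eq_zero_iff diff_self_eq_0 mset_remove1 set_mset_mset count_diff count_single)
      show ?thesis unfolding l r using eq True cnt om_ok_count[OF ok, of b]
        by (auto simp: ocoef_def icoef_def osign_insort osign_remove1' single_def swap_sign_def mult_ac)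
    next
      case False
      then have "count (mset w) c = 0" using eq by (simp add: count_eq_zero_iff)
      then show ?thesis unfolding l using eq False
        by (auto simp: ocoef_def icoef_def osign_insort single_def mult_ac simp del: count_mset_0_iff)
    qed
  next
    case out
    then have "count (mset w) b = 0" by (simp add: count_eq_zero_iff)
    then show ?thesis using out by (auto simp: icoef_def single_def simp del: count_mset_0_iff)
  next
    case ins
    have "remove1 b (insort c w) = insort c (remove1 b w)" using ins srt
      by (intro sorted_eqI) (auto simp: sorted_insort sorted_remove1)
    then show ?thesis using ins
      by (auto simp: ocoef_def icoef_def osign_insort osign_remove1' single_def mult_ac swap_sign_sym[of m c b])
  qed
qed

text \<open>Both insertion orders give the same sorted list, so the signs differ only by the
  transposition of \<open>a\<close> and \<open>c\<close>; for equal even indices both sides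
  vanish.\<close>

lemma wedge_swap:
  assumes ok: "om_ok m w"
  shows "single (ocoef m w c * ocoef m (insort c w) a) (insort a (insort c w)) u
     = swap_sign m a c * single (ocoef m w a * ocoef m (insort a w) c) (insort c (insort a w)) (u :: nat list)"
proof -
  note srt = om_ok_sorted[OF ok]
  have eq: "insort a (insort c w) = insort c (insort a w)" using srt
    by (intro sorted_eqI) (auto simp: sorted_insort)
  show ?thesis unfolding eq
    by (cases "a = c")
      (auto simp: ocoef_def osign_insort single_def mult_ac swap_sign_def[of m c c] set_insort_key swap_sign_sym[of m c a])
qed

section \<open>Normal forms of products and the gl(m|n)-action\<close>

lemma oprod_snoc: "(oprod m (cs @ [c]) :: 'a::comm_ring_1 \<times> nat list) =
   (fst (oprod m cs :: 'a \<times> nat list) * ocoef m (snd (oprod m cs :: 'a \<times> nat list)) c,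
    snd (owedge m (snd (oprod m cs :: 'a \<times> nat list)) c :: 'a \<times> nat list))"
  by (simp add: oprod_def owedge_fst)

lemma om_ok_oprod: "om_ok m (snd (oprod m cs :: 'a::comm_ring_1 \<times> nat list))"
proof (induction cs rule: rev_induct)
  case Nil
  then show ?case by (simp add: oprod_def om_ok_def)
next
  case (snoc c cs)
  have "om_ok m (snd (owedge m w c :: 'a \<times> nat list))" if "om_ok m w" for w
    using that by (auto simp: owedge_def om_ok_insort)
  from this[OF snoc.IH] show ?case
    by (subst oprod_snoc) simp
qed

lemma owedge_last:
  "om_ok m (w @ [c]) \<Longrightarrow> owedge m w c = (1 :: 'a::comm_ring_1, w @ [c])"
proof -
  assume ok: "om_ok m (w @ [c])"
  then have s: "sorted (w @ [c])" and "\<not> (c < m \<and> c \<in> set w)"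
    by (auto simp: om_ok_def)
  moreover have "filter (\<lambda>d. c < d) w = []" using s by (auto simp: sorted_append filter_empty_conv)
  moreover have "insort c w = w @ [c]" using s
    by (intro sorted_eqI) (auto simp: sorted_insort sorted_append)
  ultimately show ?thesis by (simp add: owedge_def)
qed

lemma oprod_om_ok: "om_ok m w \<Longrightarrow> oprod m w = (1 :: 'a::comm_ring_1, w)"
proof (induction w rule: rev_induct)
  case Nil
  then show ?case by (simp add: oprod_def)
next
  case (snoc c w)
  have "om_ok m w" using snoc.prems by (auto simp: om_ok_def sorted_append)
  with snoc.IH have IH: "oprod m w = (1 :: 'a::comm_ring_1, w)" by simp
  show ?case
    using owedge_last[OF snoc.prems, where 'a='a] owedge_fst[of m w c, where 'a='a]
    by (simp add: oprod_snoc IH)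
qed

lemma opar_snoc: "opar m (cs @ [c]) = (opar m cs \<noteq> (m \<le> c))"
  by (auto simp: opar_def)

lemma sgn_nonzero [simp]: "sgn x \<noteq> (0 :: 'a::comm_ring_1)"
  by (auto simp: sgn_def)

text \<open>Replacing a factor \<open>e_b\<close> by \<open>e_a\<close> amounts to contracting by
  \<open>b\<close> and wedging with \<open>e_a\<close> on the right; an odd \<open>E_ab\<close> pays
  the parity of the remaining factors that it passes. A replacement destroys sortedness, so the
  induction runs over arbitrary lists and compares normal forms.\<close>

lemma xi_eq_contraction_wedge_oprod:
  fixes m a b :: nat
  defines "W \<equiv> \<lambda>cs. snd (oprod m cs :: 'a::comm_ring_1 \<times> nat list)"
    and "C \<equiv> \<lambda>cs. fst (oprod m cs :: 'a \<times> nat list)"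
  shows "xi m a b cs u = single (sgn (((m \<le> a) \<noteq> (m \<le> b)) \<and> (opar m cs \<noteq> (m \<le> b))) * C cs *
     (icoef m b (W cs) * ocoef m (remove1 b (W cs)) a)) (insort a (remove1 b (W cs))) u"
proof (induction cs arbitrary: u rule: rev_induct)
  case Nil
  then show ?case by (simp add: xi_def W_def oprod_def icoef_def)
next
  case (snoc c cs)
  let ?s = "\<lambda>cs. sgn (((m \<le> a) \<noteq> (m \<le> b)) \<and> (opar m cs \<noteq> (m \<le> b))) :: 'a"
  let ?t = "\<lambda>j. sgn (((m \<le> a) \<noteq> (m \<le> b)) \<and> opar m (take j cs)) :: 'a"
  let ?A = "{j \<in> {..<length cs}. cs ! j = b}"
  let ?w = "W cs" and ?r = "remove1 b (W cs)"
  have ok: "om_ok m ?w" unfolding W_def by (rule om_ok_oprod)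
  have xi1: "xi m a b cs u = (\<Sum>j\<in>?A. single (?t j * C (cs[j := a])) (W (cs[j := a])) u)" for u
    unfolding xi_def C_def W_def
    by (subst sum.inter_filter) (auto simp: single_def intro!: sum.cong)
  \<comment> \<open>The induction hypothesis, an identity of combinations of monomials, is
    multiplied on the right by \<open>e_c\<close>.\<close>
  have wedge: "(\<Sum>j\<in>?A. (?t j * C (cs[j := a])) * single (ocoef m (W (cs[j := a])) c) (insort c (W (cs[j := a]))) u)
    = ?s cs * C cs * (icoef m b ?w * ocoef m ?r a)
       * single (ocoef m (insort a ?r) c) (insort c (insort a ?r)) u"
    by (rule sum_single_transfer[where H = "\<lambda>v. single (ocoef m v c) (insort c v) u" and \<beta> = "\<lambda>j. W (cs[j := a])"])
      (simp, subst snoc.IH[symmetric], rule xi1[symmetric])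
  \<comment> \<open>The replaced position is either inside \<open>cs\<close> or the new last
    factor.\<close>
  have "xi m a b (cs @ [c]) u
      = (\<Sum>j\<in>?A. single (?t j * fst (oprod m (cs[j := a] @ [c]) :: 'a \<times> nat list)) (snd (oprod m (cs[j := a] @ [c]) :: 'a \<times> nat list)) u)
        + (if c = b then single (sgn (((m \<le> a) \<noteq> (m \<le> b)) \<and> opar m cs) * fst (oprod m (cs @ [a]) :: 'a \<times> nat list)) (snd (oprod m (cs @ [a]) :: 'a \<times> nat list)) u else 0)"
    unfolding xi_def
    by (subst sum.inter_filter) (auto simp: single_def nth_append list_update_append intro!: sum.cong)
  also have "\<dots> = (\<Sum>j\<in>?A. (?t j * C (cs[j := a])) * single (ocoef m (W (cs[j := a])) c) (insort c (W (cs[j := a]))) u)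
        + (if c = b then single (sgn (((m \<le> a) \<noteq> (m \<le> b)) \<and> opar m cs) * C cs * ocoef m ?w a) (insort a ?w) u else 0)"
    unfolding oprod_snoc fst_conv snd_conv mult.assoc[symmetric] owedge_single
    by (simp add: C_def W_def single_mult_left)
  also have "\<dots> = ?s cs * C cs * single (icoef m b ?w * ocoef m ?r a * ocoef m (insort a ?r) c) (insort c (insort a ?r)) u
        + (if c = b then single (sgn (((m \<le> a) \<noteq> (m \<le> b)) \<and> opar m cs) * C cs * ocoef m ?w a) (insort a ?w) u else 0)"
    unfolding wedge by (simp add: single_mult_left mult_ac)
  finally have L: "xi m a b (cs @ [c]) u = \<dots>" .

  have CW: "C (cs @ [c]) = C cs * ocoef m ?w c"
    "W (cs @ [c]) = snd (owedge m ?w c :: 'a \<times> nat list)"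
    by (simp_all add: C_def W_def oprod_snoc)
  have "single (?s (cs @ [c]) * C (cs @ [c]) * (icoef m b (W (cs @ [c])) * ocoef m (remove1 b (W (cs @ [c]))) a))
           (insort a (remove1 b (W (cs @ [c])))) u
     = ?s (cs @ [c]) * C cs * ((ocoef m ?w c * icoef m b (insort c ?w)) *
           single (ocoef m (remove1 b (insort c ?w)) a) (insort a (remove1 b (insort c ?w))) u)"
    unfolding CW by (auto simp: owedge_def ocoef_def[of m "W cs" c] single_mult_left mult_ac)
  \<comment> \<open>The contraction-wedge relation is composed with the wedge by \<open>e_a\<close>;
    \<open>?V\<close> collects the three monomials that can occur, so that the sums are
    finite.\<close>
  also have "(ocoef m ?w c * icoef m b (insort c ?w) :: 'a) *
           single (ocoef m (remove1 b (insort c ?w)) a) (insort a (remove1 b (insort c ?w))) u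
     = (if b = c then single (ocoef m ?w a) (insort a ?w) u else 0)
       + swap_sign m b c * (icoef m b ?w * ocoef m ?r c) * single (ocoef m (insort c ?r) a) (insort a (insort c ?r)) u"
  proof -
    let ?H = "\<lambda>v. single (ocoef m v a) (insort a v) u :: 'a"
    let ?V = "{remove1 b (insort c ?w), ?w, insort c ?r}"
    have "(\<Sum>v\<in>?V. single x y v * ?H v) = x * ?H y" if "y \<in> ?V" for x y
    proof -
      have "(\<Sum>v\<in>?V. single x y v * ?H v) = (\<Sum>v\<in>?V. if y = v then x * ?H v else 0)"
        by (intro sum.cong) (auto simp: single_def)
      also have "\<dots> = x * ?H y" using that by (subst sum.delta') auto
      finally show ?thesis .
    qed
    note H = this
    have "(ocoef m ?w c * icoef m b (insort c ?w)) * ?H (remove1 b (insort c ?w))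
      = (\<Sum>v\<in>?V. single (ocoef m ?w c * icoef m b (insort c ?w)) (remove1 b (insort c ?w)) v * ?H v)"
      by (subst H) auto
    also have "\<dots> = (\<Sum>v\<in>?V. (if b = c then single 1 ?w v * ?H v else 0) +
        swap_sign m b c * (single (icoef m b ?w * ocoef m ?r c) (insort c ?r) v * ?H v))"
      by (intro sum.cong refl, subst contraction_wedge[OF ok]) (simp add: algebra_simps)
    also have "\<dots> = (if b = c then (\<Sum>v\<in>?V. single 1 ?w v * ?H v) else 0) +
        swap_sign m b c * (\<Sum>v\<in>?V. single (icoef m b ?w * ocoef m ?r c) (insort c ?r) v * ?H v)"
      by (cases "b = c")
        (simp_all only: if_True if_False sum.distrib sum_distrib_left sum.neutral_const simp_thms)
    also have "\<dots> = (if b = c then ?H ?w else 0) +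
        swap_sign m b c * ((icoef m b ?w * ocoef m ?r c) * ?H (insort c ?r))"
      by (subst H, simp, subst H) simp_all
    finally show ?thesis by (simp only: mult.assoc)
  qed
  also have "(swap_sign m b c * (icoef m b ?w * ocoef m ?r c) :: 'a) * single (ocoef m (insort c ?r) a) (insort a (insort c ?r)) u
     = swap_sign m b c * icoef m b ?w * single (ocoef m ?r c * ocoef m (insort c ?r) a) (insort a (insort c ?r)) u"
    by (simp add: single_mult_left mult_ac)
  also have "\<dots> = swap_sign m b c * swap_sign m a c * single (icoef m b ?w * ocoef m ?r a * ocoef m (insort a ?r) c) (insort c (insort a ?r)) u"
    by (subst wedge_swap[OF om_ok_remove1[OF ok]]) (simp add: single_mult_left mult_ac)
  finally have R: "single (?s (cs @ [c]) * C (cs @ [c]) * (icoef m b (W (cs @ [c])) * ocoef m (remove1 b (W (cs @ [c]))) a))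
           (insort a (remove1 b (W (cs @ [c])))) u =
     ?s (cs @ [c]) * C cs * ((if b = c then single (ocoef m ?w a) (insort a ?w) u else 0) +
        swap_sign m b c * swap_sign m a c * single (icoef m b ?w * ocoef m ?r a * ocoef m (insort a ?r) c) (insort c (insort a ?r)) u)" .
  \<comment> \<open>The new factor changes the sign of \<open>E_ab\<close> exactly when both are
    odd, which is when the two swap signs multiply to -1.\<close>
  have s1: "?s (cs @ [c]) * (swap_sign m b c * swap_sign m a c) = ?s cs"
    by (auto simp: sgn_def swap_sign_def opar_snoc)
  have s2: "?s (cs @ [c]) = sgn (((m \<le> a) \<noteq> (m \<le> b)) \<and> opar m cs)" if "b = c"
    using that by (auto simp: sgn_def opar_snoc)
  have "(if c = b then single (sgn (((m \<le> a) \<noteq> (m \<le> b)) \<and> opar m cs) * C cs * ocoef m ?w a) (insort a ?w) u else 0)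
     = ?s (cs @ [c]) * C cs * (if b = c then single (ocoef m ?w a) (insort a ?w) u else 0)"
  proof (cases "b = c")
    case True
    show ?thesis unfolding s2[OF True] using True by (simp add: single_mult_left mult.assoc)
  qed simp
  then show ?case unfolding L R s1[symmetric] distrib_left by (simp only: mult_ac add_ac)
qed

lemma xi_eq_contraction_wedge:
  assumes "om_ok m w"
  shows "xi m a b w u = sgn (((m \<le> a) \<noteq> (m \<le> b)) \<and> (opar m w \<noteq> (m \<le> b))) *
     single (icoef m b w * ocoef m (remove1 b w) a) (insort a (remove1 b w)) u"
  by (simp add: xi_eq_contraction_wedge_oprod oprod_om_ok[OF assms] single_mult_left)

section \<open>Monomials and derivations of \<open>R\<close>\<close>

definition dmon :: "nat \<Rightarrow> nat \<Rightarrow> rmon \<Rightarrow> rmon" where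
  "dmon m a g = (if a < m then ((fst g)(a := fst g a - 1), snd g) else (fst g, snd g - {a - m}))"

definition dcoef :: "nat \<Rightarrow> nat \<Rightarrow> rmon \<Rightarrow> 'a::comm_ring_1" where
  "dcoef m a g = (if a < m then of_nat (fst g a)
     else if a - m \<in> snd g then (- 1) ^ card {s \<in> snd g. s < a - m} else 0)"

definition mmon :: "rmon \<Rightarrow> rmon \<Rightarrow> rmon" where
  "mmon f g = (\<lambda>i. fst f i + fst g i, snd f \<union> snd g)"

text \<open>The sign that sorts the concatenation of the increasing products over \<open>A\<close>
  and \<open>B\<close>: a factor -1 for each inversion.\<close>

definition isign :: "nat set \<Rightarrow> nat set \<Rightarrow> 'a::comm_ring_1" where
  "isign A B = (- 1) ^ card {(a, b). a \<in> A \<and> b \<in> B \<and> b < a}"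

definition mcoef :: "rmon \<Rightarrow> rmon \<Rightarrow> 'a::comm_ring_1" where
  "mcoef f g = (if snd f \<inter> snd g = {} then isign (snd f) (snd g) else 0)"

lemma rdx_eq: "a < m \<Longrightarrow> rdx a g = (dcoef m a g, dmon m a g)"
  by (simp add: rdx_def dcoef_def dmon_def)

lemma rdy_eq: "rdy a g = (dcoef m (m + a) g, dmon m (m + a) g)"
  by (simp add: rdy_def dcoef_def dmon_def)

lemma rmul_eq: "rmul f g = (mcoef f g, mmon f g)"
  by (simp add: rmul_def mcoef_def mmon_def isign_def)

text \<open>The inversions lost with \<open>s\<close> are its pairs with the smaller elements of
  \<open>B\<close>.\<close>

lemma isign_remove_left:
  assumes "finite A" "finite B" "s \<in> A"
  shows "isign A B = isign (A - {s}) B * (- 1) ^ card {b \<in> B. b < s}"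
proof -
  let ?P = "{(a, b). a \<in> A - {s} \<and> b \<in> B \<and> b < a}"
  have "finite ?P" by (rule finite_subset[of _ "A \<times> B"]) (use assms in auto)
  moreover have "{(a, b). a \<in> A \<and> b \<in> B \<and> b < a} = ?P \<union> Pair s ` {b \<in> B. b < s}"
    using assms(3) by auto
  moreover have "card (Pair s ` {b \<in> B. b < s}) = card {b \<in> B. b < s}"
    by (rule card_image) (simp add: inj_on_def)
  moreover have "card (?P \<union> Pair s ` {b \<in> B. b < s}) = card ?P + card (Pair s ` {b \<in> B. b < s})"
    using assms \<open>finite ?P\<close> by (intro card_Un_disjoint) auto
  ultimately show ?thesis unfolding isign_def by (simp add: power_add)
qed

lemma isign_remove_right:
  assumes "finite A" "finite B" "s \<in> B"
  shows "isign A B = isign A (B - {s}) * (- 1) ^ card {a \<in> A. s < a}"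
proof -
  let ?P = "{(a, b). a \<in> A \<and> b \<in> B - {s} \<and> b < a}"
  let ?Q = "(\<lambda>a. (a, s)) ` {a \<in> A. s < a}"
  have "finite ?P" by (rule finite_subset[of _ "A \<times> B"]) (use assms in auto)
  moreover have "{(a, b). a \<in> A \<and> b \<in> B \<and> b < a} = ?P \<union> ?Q"
    using assms(3) by auto
  moreover have "card ?Q = card {a \<in> A. s < a}"
    by (rule card_image) (simp add: inj_on_def)
  moreover have "card (?P \<union> ?Q) = card ?P + card ?Q"
    using assms \<open>finite ?P\<close> by (intro card_Un_disjoint) auto
  ultimately show ?thesis unfolding isign_def by (simp add: power_add)
qed

lemma card_less_Un:
  assumes "finite A" "finite B" "A \<inter> B = {}"
  shows "card {x \<in> A \<union> B. x < s} = card {x \<in> A. x < s} + card {x \<in> B. x < (s::nat)}"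
proof -
  have "{x \<in> A \<union> B. x < s} = {x \<in> A. x < s} \<union> {x \<in> B. x < s}" by auto
  then show ?thesis using assms by (simp add: card_Un_disjoint disjoint_iff)
qed

lemma card_split_at:
  assumes "finite A"
  shows "card A = card {x \<in> A. x < s} + card {x \<in> A. s < x} + (if (s::nat) \<in> A then 1 else 0)"
proof -
  have "A = ({x \<in> A. x < s} \<union> {x \<in> A. s < x}) \<union> (A \<inter> {s})" by auto
  then have "card A = card ({x \<in> A. x < s} \<union> {x \<in> A. s < x}) + card (A \<inter> {s})"
    using assms by (subst card_Un_disjoint[symmetric]) auto
  also have "card ({x \<in> A. x < s} \<union> {x \<in> A. s < x}) = card {x \<in> A. x < s} + card {x \<in> A. s < x}"
    using assms by (intro card_Un_disjoint) auto
  finally show ?thesis by auto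
qed

lemma minus_one_power_square [simp]: "(- 1) ^ k * ((- 1) ^ k * x) = (x :: 'a::comm_ring_1)"
  by (simp add: mult.assoc[symmetric] flip: power_add)

lemma sgn_rpar: "sgn (rpar f) = (- 1) ^ card (snd f)"
  by (simp add: sgn_def rpar_def)

text \<open>Super Leibniz rule on monomials. For even \<open>j\<close> the exponents add; for odd
  \<open>j\<close> the inversions involving the generator are counted according to which factors
  contain it.\<close>

lemma leibniz:
  assumes fin: "finite (snd f)" "finite (snd g)"
  shows "single (mcoef f g * dcoef m j (mmon f g)) (dmon m j (mmon f g)) u
    = single (dcoef m j f * mcoef (dmon m j f) g) (mmon (dmon m j f) g) u
      + sgn (m \<le> j \<and> rpar f) * single (dcoef m j g * mcoef f (dmon m j g) :: 'a::comm_ring_1) (mmon f (dmon m j g)) u"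
proof (cases "j < m")
  case True
  have mc: "mcoef (dmon m j f) g = (mcoef f g :: 'a)" "mcoef f (dmon m j g) = (mcoef f g :: 'a)"
    using True by (simp_all add: mcoef_def dmon_def)
  \<comment> \<open>Because of truncated subtraction the monomials agree only for a positive
    exponent; otherwise the coefficient is 0.\<close>
  have f: "mmon (dmon m j f) g = dmon m j (mmon f g)" if "fst f j \<noteq> 0"
    using True that by (auto simp: mmon_def dmon_def fun_eq_iff)
  have g: "mmon f (dmon m j g) = dmon m j (mmon f g)" if "fst g j \<noteq> 0"
    using True that by (auto simp: mmon_def dmon_def fun_eq_iff)
  have dc: "dcoef m j f = of_nat (fst f j)" "dcoef m j g = of_nat (fst g j)"
    "dcoef m j (mmon f g) = of_nat (fst f j) + of_nat (fst g j)"
    using True by (simp_all add: dcoef_def mmon_def)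
  show ?thesis
    using f g True unfolding mc dc
    by (cases "fst f j = 0"; cases "fst g j = 0") (auto simp: single_def sgn_def algebra_simps)
next
  case False
  define s where "s = j - m"
  let ?A = "snd f" and ?B = "snd g"
  let ?N = "\<lambda>A. card {x \<in> A. x < s}"
  have dm: "dmon m j g = (fst g, snd g - {s})" for g using False by (simp add: dmon_def s_def)
  have dc: "dcoef m j g = (if s \<in> snd g then (- 1) ^ ?N (snd g) else 0)" for g
    using False by (simp add: dcoef_def s_def)
  have sg: "sgn (m \<le> j \<and> rpar f) = (- 1) ^ card ?A" using False by (simp add: sgn_rpar)
  consider "s \<notin> ?A" "s \<notin> ?B" | "s \<in> ?A" "s \<notin> ?B" | "s \<notin> ?A" "s \<in> ?B" | "s \<in> ?A" "s \<in> ?B" by blast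
  then show ?thesis
  proof cases
    case 1
    then show ?thesis by (simp add: dc mmon_def)
  next
    case 2
    have e: "?A \<union> ?B - {s} = (?A - {s}) \<union> ?B" using 2 by auto
    have d: "(?A - {s}) \<inter> ?B = {} \<longleftrightarrow> ?A \<inter> ?B = {}" using 2 by auto
    show ?thesis using 2 isign_remove_left[OF fin 2(1), where 'a='a] card_less_Un[OF fin, of s]
      by (simp add: dc dm mmon_def mcoef_def single_def e d power_add mult_ac)
  next
    case 3
    have e: "?A \<union> ?B - {s} = ?A \<union> (?B - {s})" using 3 by auto
    have d: "?A \<inter> (?B - {s}) = {} \<longleftrightarrow> ?A \<inter> ?B = {}" using 3 by auto
    show ?thesis using 3 isign_remove_right[OF fin 3(2), where 'a='a] card_less_Un[OF fin, of s]
        card_split_at[OF fin(1), of s]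
      by (simp add: dc dm sg mmon_def mcoef_def single_def e d power_add mult_ac)
  next
    case 4
    \<comment> \<open>Both factors contain \<open>y_s\<close>: the product on the left is 0, and the
      two terms on the right cancel.\<close>
    have e: "(?A - {s}) \<union> ?B = ?A \<union> ?B" "?A \<union> (?B - {s}) = ?A \<union> ?B" using 4 by auto
    have d: "?A \<inter> (?B - {s}) = {} \<longleftrightarrow> (?A - {s}) \<inter> ?B = {}" "?A \<inter> ?B \<noteq> {}" using 4 by auto
    have "isign (?A - {s}) ?B = (isign ?A ?B * (- 1) ^ ?N ?B :: 'a)"
      using isign_remove_left[OF fin 4(1), where 'a='a] by (simp add: mult_ac)
    moreover have "isign ?A (?B - {s}) = (isign ?A ?B * (- 1) ^ card {a \<in> ?A. s < a} :: 'a)"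
      using isign_remove_right[OF fin 4(2), where 'a='a] by (simp add: mult_ac)
    ultimately show ?thesis using 4 card_split_at[OF fin(1), of s]
      by (simp add: dc dm sg mmon_def mcoef_def single_def e d power_add mult_ac)
  qed
qed

lemma rpar_dmon:
  assumes "finite (snd g)" "dcoef m a g \<noteq> (0 :: 'a::comm_ring_1)"
  shows "rpar (dmon m a g) = (rpar g \<noteq> (m \<le> a))"
  using assms by (cases "a < m") (auto simp: rpar_def dmon_def dcoef_def card_gt_0_iff split: if_splits)

lemma rpar_mmon:
  assumes "finite (snd f)" "finite (snd g)" "mcoef f g \<noteq> (0 :: 'a::comm_ring_1)"
  shows "rpar (mmon f g) = (rpar f \<noteq> rpar g)"
  using assms by (auto simp: rpar_def mmon_def mcoef_def card_Un_disjoint split: if_splits)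

text \<open>Partial derivatives supercommute, \<open>- swap_sign m a c\<close> being
  (-1)^(p(a)p(c)). For two odd indices the sign arises because deleting one generator can shift the
  position of the other.\<close>

lemma derivation_swap:
  assumes fin: "finite (snd g)"
  shows "single (dcoef m a g * dcoef m c (dmon m a g)) (dmon m c (dmon m a g)) u
    = - swap_sign m a c * single (dcoef m c g * dcoef m a (dmon m c g) :: 'a::comm_ring_1) (dmon m a (dmon m c g)) u"
proof (cases "m \<le> a \<and> m \<le> c")
  case False
  have e: "dmon m c (dmon m a g) = dmon m a (dmon m c g)"
    using False by (auto simp: dmon_def fun_eq_iff)
  show ?thesis unfolding e using False
    by (auto simp: single_def swap_sign_def dmon_def dcoef_def mult_ac)
next
  case True
  define s t where "s = a - m" and "t = c - m"
  let ?N = "\<lambda>s A. card {x \<in> A. x < s}"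
  have e: "dmon m c (dmon m a g) = dmon m a (dmon m c g)"
    using True by (auto simp: dmon_def)
  have N: "(- 1) ^ card {x \<in> A. x \<noteq> s \<and> x < t} = ((- 1) ^ ?N t A * (if s < t then -1 else 1) :: 'a)"
    if "finite A" "s \<in> A" for s t A
  proof (cases "s < t")
    case True
    have "{x \<in> A. x \<noteq> s \<and> x < t} = {x \<in> A. x < t} - {s}" by auto
    moreover have "Suc (card ({x \<in> A. x < t} - {s})) = ?N t A"
      using that True by (intro card_Suc_Diff1) auto
    ultimately show ?thesis using True by (simp flip: \<open>Suc _ = _\<close>)
  next
    case False
    then have "{x \<in> A. x \<noteq> s \<and> x < t} = {x \<in> A. x < t}" by auto
    with False show ?thesis by simp
  qed
  show ?thesis unfolding e
    using True fin
    by (cases "s = t") (auto simp: single_def swap_sign_def dmon_def dcoef_def N mult_ac s_def[symmetric] t_def[symmetric])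
qed

section \<open>Differential and vector fields over a common index range\<close>

lemma ddb_eq: "ddb m n (g, w) b' = (\<Sum>a<m + n.
    single (sgn (m \<le> a \<and> opar m w = rpar g) * dcoef m a g * ocoef m w a) (dmon m a g, insort a w) (b' :: bas))"
proof -
  have s: "single (x * ocoef m w c) (r, snd (owedge m w c :: 'a::comm_ring_1 \<times> nat list)) b'
     = single (x * ocoef m w c) (r, insort c w) b'" for x :: 'a and c and r :: rmon
    by (auto simp: single_def owedge_def ocoef_def)
  show ?thesis
    unfolding ddb_def Let_def sum_lessThan_add sum_distrib_left
    by (intro arg_cong2[of _ _ _ _ "(+)"] sum.cong refl; subst s[symmetric])
      (simp_all add: rdx_eq rdy_eq[of _ _ m] owedge_fst single_def sgn_def)
qed

definition vfield :: "nat \<Rightarrow> rmon \<Rightarrow> nat \<Rightarrow> vf" where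
  "vfield m f a = (f, m \<le> a, if m \<le> a then a - m else a)"

lemma valid_vfE:
  assumes "valid_vf m n X"
  obtains f a where "X = vfield m f a" "valid_rmon m n f" "a < m + n"
proof
  obtain f d i where X: "X = (f, d, i)" by (cases X)
  show "X = vfield m (fst X) (if fst (snd X) then m + snd (snd X) else snd (snd X))"
    using assms by (auto simp: X valid_vf_def vfield_def)
qed (use assms in \<open>auto simp: valid_vf_def\<close>)

lemma valid_vfield: "valid_rmon m n f \<Longrightarrow> a < m + n \<Longrightarrow> valid_vf m n (vfield m f a)"
  by (auto simp: valid_vf_def vfield_def)

text \<open>One sign expression covers the four cases of the mixed-product formulas, given by the
  parities of \<open>a\<close> and \<open>j\<close>, so that both kinds of vector fields can be
  treated at once.\<close>

lemma actb_vfield: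
  "actb m n (vfield m f a) (g, w) (g', w')
   = single (dcoef m a g * mcoef f (dmon m a g)) (mmon f (dmon m a g)) g' * single 1 w w'
     + (\<Sum>j<m + n. sgn ((m \<le> a \<and> rpar g) \<noteq> (m \<le> j \<and> rpar f = rpar g)) *
          single (dcoef m j f * mcoef (dmon m j f) g) (mmon (dmon m j f) g) g' * xi m j a w w' :: 'a::comm_ring_1)"
proof (cases "m \<le> a")
  case True
  then have a: "m + (a - m) = a" by simp
  have r: "rdy (a - m) g = (dcoef m a g :: 'a, dmon m a g)" using rdy_eq[of "a - m" g m] a by simp
  show ?thesis
    unfolding actb_def vfield_def Let_def sum_lessThan_add
    by (simp only: True if_True sum_distrib_left add.assoc r a rmul_eq fst_conv snd_conv)
      (intro arg_cong2[of _ _ _ _ "(+)"] sum.cong refl;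
        auto simp: rdx_eq rdy_eq[of _ _ m] rmul_eq single_def sgn_def)
next
  case False
  then have r: "rdx a g = (dcoef m a g :: 'a, dmon m a g)" by (simp add: rdx_eq)
  show ?thesis
    unfolding actb_def vfield_def Let_def sum_lessThan_add
    by (simp only: False r if_False sum_distrib_left add.assoc rmul_eq fst_conv snd_conv)
      (intro arg_cong2[of _ _ _ _ "(+)"] sum.cong refl;
        use False in \<open>auto simp: rdx_eq rdy_eq[of _ _ m] rmul_eq single_def sgn_def\<close>)
qed

section \<open>Linear extension and the Cartan formula\<close>

abbreviation fin_supp :: "'a::zero vec \<Rightarrow> bool" where
  "fin_supp v \<equiv> finite {b. v b \<noteq> 0}"

lemma lext_superset:
  assumes "finite B" "{b. v b \<noteq> 0} \<subseteq> B"
  shows "lext F v b' = (\<Sum>b\<in>B. v b * F b b')"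
  unfolding lext_def using assms by (intro sum.mono_neutral_left) auto

lemma sum_nonzero_ex: "(\<Sum>i\<in>A. f i) \<noteq> 0 \<Longrightarrow> \<exists>i\<in>A. f i \<noteq> 0"
  by (meson sum.neutral)

lemma fin_supp_sum:
  assumes "finite A" "\<And>i. i \<in> A \<Longrightarrow> fin_supp (u i)"
  shows "fin_supp (\<lambda>b. \<Sum>i\<in>A. u i b)"
proof (rule finite_subset)
  show "{b. (\<Sum>i\<in>A. u i b) \<noteq> 0} \<subseteq> (\<Union>i\<in>A. {b. u i b \<noteq> 0})"
    using sum_nonzero_ex by fastforce
qed (use assms in auto)

lemma fin_supp_single: "fin_supp (single c b)"
  by (rule finite_subset[of _ "{b}"]) (auto simp: single_def)

lemma lext_single: "lext F (single c b) b' = c * F b b'"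
  by (subst lext_superset[of "{b}"]) (auto simp: single_def)

lemma lext_add:
  assumes "fin_supp u" "fin_supp v"
  shows "lext F (\<lambda>b. u b + v b) b' = lext F u b' + lext F v b'"
proof -
  let ?B = "{b. u b \<noteq> 0} \<union> {b. v b \<noteq> 0}"
  have "finite ?B" using assms by simp
  moreover have "{b. u b + v b \<noteq> 0} \<subseteq> ?B" by auto
  ultimately show ?thesis
    by (simp add: lext_superset[of ?B] distrib_right sum.distrib)
qed

lemma lext_scale:
  assumes "fin_supp u"
  shows "lext F (\<lambda>b. c * u b) b' = c * lext F u (b' :: bas)"
proof -
  have "lext F (\<lambda>b. c * u b) b' = (\<Sum>b | u b \<noteq> 0. c * u b * F b b')"
    by (rule lext_superset[OF assms]) auto
  then show ?thesis by (simp add: lext_def sum_distrib_left mult.assoc)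
qed

lemma lext_zero [simp]: "lext F (\<lambda>_. 0) = (\<lambda>_. 0)"
  by (simp add: lext_def fun_eq_iff)

lemma lext_cong: "(\<And>b. v b \<noteq> 0 \<Longrightarrow> F b b' = G b b') \<Longrightarrow> lext F v b' = lext G v b'"
  unfolding lext_def by (intro sum.cong) auto

lemma lext_sum:
  assumes "finite A" "\<And>i. i \<in> A \<Longrightarrow> fin_supp (u i)"
  shows "lext F (\<lambda>b. \<Sum>i\<in>A. u i b) b' = (\<Sum>i\<in>A. lext F (u i) (b' :: bas))"
proof -
  let ?B = "\<Union>i\<in>A. {b. u i b \<noteq> 0}"
  have fin: "finite ?B" using assms by simp
  have "{b. (\<Sum>i\<in>A. u i b) \<noteq> 0} \<subseteq> ?B" using sum_nonzero_ex by fastforce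
  then have "lext F (\<lambda>b. \<Sum>i\<in>A. u i b) b' = (\<Sum>b\<in>?B. \<Sum>i\<in>A. u i b * F b b')"
    by (simp only: lext_superset[OF fin] sum_distrib_right)
  also have "\<dots> = (\<Sum>i\<in>A. \<Sum>b\<in>?B. u i b * F b b')" by (rule sum.swap)
  also have "\<dots> = (\<Sum>i\<in>A. lext F (u i) b')"
    by (intro sum.cong refl lext_superset[OF fin, symmetric]) auto
  finally show ?thesis .
qed

lemma lext_sum_single:
  assumes "finite A"
  shows "lext F (\<lambda>b'. \<Sum>i\<in>A. single (c i) (\<beta> i) b') b' = (\<Sum>i\<in>A. c i * F (\<beta> i) (b' :: bas))"
  by (simp add: lext_sum[OF assms fin_supp_single] lext_single)

lemma fin_supp_scale: "fin_supp u \<Longrightarrow> fin_supp (\<lambda>b. c * u b)" for c :: "'a::comm_ring_1"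
  by (erule rev_finite_subset) auto

text \<open>Reduces identities between composed operators to a check on basis elements.\<close>

lemma lext_lext:
  fixes v :: "'a::comm_ring_1 vec"
  assumes "fin_supp v" "\<And>b. v b \<noteq> 0 \<Longrightarrow> fin_supp (G b)"
  shows "lext F (lext G v) b' = lext (\<lambda>b. lext F (G b)) v b'"
proof -
  have "lext F (lext G v) b' = lext F (\<lambda>b''. \<Sum>b | v b \<noteq> 0. v b * G b b'') b'"
    by (simp only: lext_def[of G])
  also have "\<dots> = (\<Sum>b | v b \<noteq> 0. lext F (\<lambda>b''. v b * G b b'') b')"
    using assms by (intro lext_sum fin_supp_scale) auto
  also have "\<dots> = (\<Sum>b | v b \<noteq> 0. v b * lext F (G b) b')"
    using assms by (intro sum.cong lext_scale) auto
  finally show ?thesis by (simp add: lext_def)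
qed

text \<open>The sign mirrors that of the differential: it is nontrivial only for odd
  \<open>a\<close> and equal parities of the two tensor factors.\<close>

definition iotab :: "nat \<Rightarrow> rmon \<Rightarrow> nat \<Rightarrow> bas \<Rightarrow> bas \<Rightarrow> 'a::comm_ring_1" where
  "iotab m f a b = single (sgn (m \<le> a \<and> rpar (fst b) = opar m (snd b)) * mcoef f (fst b) * icoef m a (snd b))
      (mmon f (fst b), remove1 a (snd b))"

lemma icoef_nonzero_in: "icoef m a w \<noteq> 0 \<Longrightarrow> a \<in> set w"
  by (metis count_eq_zero_iff icoef_def mult_zero_left of_nat_0 set_mset_mset)

lemma opar_insort: "opar m (insort a w) = (opar m w \<noteq> (m \<le> a))"
  by (induction w) (auto simp: opar_def)

lemma opar_remove1: "a \<in> set w \<Longrightarrow> opar m (remove1 a w) = (opar m w \<noteq> (m \<le> a))"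
  by (induction w) (auto simp: opar_def)

lemma ddb_fun_eq: "ddb m n (g, w) = (\<lambda>b'. \<Sum>a<m + n.
    single (sgn (m \<le> a \<and> opar m w = rpar g) * dcoef m a g * ocoef m w a) (dmon m a g, insort a w) (b' :: bas))"
  by (rule ext) (rule ddb_eq)

text \<open>The Leibniz rule splits \<open>d iota\<close> into terms with derivatives of
  \<open>f\<close> (\<open>A\<close>) and of \<open>g\<close> (\<open>B\<close>); the
  contraction-wedge relation splits \<open>iota d\<close> into a diagonal term and a term in
  \<open>B\<close>. The \<open>B j * K j\<close> parts cancel, the diagonal term is the derivation,
  and the \<open>A j * K j\<close> parts are the gl-action.\<close>

lemma cartan_basis:
  fixes f :: rmon and b' :: bas
  assumes fin: "finite (snd f)" "finite (snd (fst b))" and ok: "om_ok m (snd b)" and a: "a < m + n"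
  shows "actb m n (vfield m f a) b b' =
     lext (ddb m n) (iotab m f a b) b' + (lext (iotab m f a) (ddb m n b) b' :: 'a::comm_ring_1)"
proof -
  obtain g w where b: "b = (g, w)" by (cases b)
  obtain g' w' where b': "b' = (g', w')" by (cases b')
  have fg: "finite (snd g)" and okw: "om_ok m w" using fin ok by (simp_all add: b)
  define A where "A = (\<lambda>j. single (dcoef m j f * mcoef (dmon m j f) g) (mmon (dmon m j f) g) g' :: 'a)"
  define B where "B = (\<lambda>j. single (dcoef m j g * mcoef f (dmon m j g)) (mmon f (dmon m j g)) g' :: 'a)"
  define K where "K = (\<lambda>j. single (icoef m a w * ocoef m (remove1 a w) j) (insort j (remove1 a w)) w' :: 'a)"
  let ?L1 = "\<lambda>j. sgn (m \<le> a \<and> rpar g = opar m w) * sgn (m \<le> j \<and> (opar m w \<noteq> (m \<le> a)) = (rpar f \<noteq> rpar g)) *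
       ((A j + sgn (m \<le> j \<and> rpar f) * B j) * K j)"
  have "lext (ddb m n) (iotab m f a b) b' = (\<Sum>j<m + n. ?L1 j)"
    unfolding b b' iotab_def fst_conv snd_conv lext_single ddb_eq sum_distrib_left
  proof (intro sum.cong refl)
    fix j
    let ?x = "sgn (m \<le> a \<and> rpar g = opar m w) * mcoef f g * icoef m a w *
       single (sgn (m \<le> j \<and> opar m (remove1 a w) = rpar (mmon f g)) * dcoef m j (mmon f g) * ocoef m (remove1 a w) j)
         (dmon m j (mmon f g), insort j (remove1 a w)) (g', w') :: 'a"
    have "?x = sgn (m \<le> a \<and> rpar g = opar m w) * sgn (m \<le> j \<and> opar m (remove1 a w) = rpar (mmon f g)) *
       (single (mcoef f g * dcoef m j (mmon f g)) (dmon m j (mmon f g)) g' * K j)"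
      unfolding K_def single_Pair[symmetric] by (simp add: single_mult_left mult_ac)
    also have "\<dots> = sgn (m \<le> a \<and> rpar g = opar m w) * sgn (m \<le> j \<and> (opar m w \<noteq> (m \<le> a)) = (rpar f \<noteq> rpar g)) *
       (single (mcoef f g * dcoef m j (mmon f g)) (dmon m j (mmon f g)) g' * K j)"
    \<comment> \<open>Parities of the product and of the contracted monomial are known only for
      nonzero coefficients; otherwise both sides vanish.\<close>
    proof (cases "mcoef f g = (0::'a) \<or> icoef m a w = (0::'a)")
      case True
      then show ?thesis by (auto simp: K_def)
    next
      case False
      then have "rpar (mmon f g) = (rpar f \<noteq> rpar g)" "a \<in> set w"
        using rpar_mmon[OF fin(1) fg] icoef_nonzero_in by auto
      then show ?thesis by (simp add: opar_remove1)
    qed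
    finally show "?x = ?L1 j"
      unfolding leibniz[OF fin(1) fg] A_def B_def .
  qed
  moreover
  let ?L2 = "\<lambda>j. sgn (m \<le> j \<and> opar m w = rpar g) * sgn (m \<le> a \<and> rpar g = opar m w) *
       (B j * ((if a = j then single 1 w w' else 0) + swap_sign m a j * K j))"
  have "lext (iotab m f a) (ddb m n b) b' = (\<Sum>j<m + n. ?L2 j)"
    unfolding b b' ddb_fun_eq lext_sum_single[OF finite_lessThan]
  proof (intro sum.cong refl)
    fix j
    let ?s = "sgn (m \<le> j \<and> opar m w = rpar g) :: 'a"
    have "?s * dcoef m j g * ocoef m w j * iotab m f a (dmon m j g, insort j w) (g', w')
      = ?s * sgn (m \<le> a \<and> rpar (dmon m j g) = opar m (insort j w)) *
         (B j * single (ocoef m w j * icoef m a (insort j w)) (remove1 a (insort j w)) w')"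
      unfolding iotab_def B_def single_Pair[symmetric] by (simp add: single_mult_left mult_ac)
    also have "\<dots> = ?s * sgn (m \<le> a \<and> rpar g = opar m w) *
         (B j * single (ocoef m w j * icoef m a (insort j w)) (remove1 a (insort j w)) w')"
    proof (cases "dcoef m j g = (0::'a)")
      case True
      then show ?thesis by (simp add: B_def)
    next
      case False
      have "(rpar (dmon m j g) = opar m (insort j w)) = (rpar g = opar m w)"
        unfolding rpar_dmon[OF fg False] opar_insort by auto
      then show ?thesis by simp
    qed
    finally show "?s * dcoef m j g * ocoef m w j * iotab m f a (dmon m j g, insort j w) (g', w') = ?L2 j"
      unfolding contraction_wedge[OF okw] K_def .
  qed
  moreover
  let ?R = "\<lambda>j. sgn ((m \<le> a \<and> rpar g) \<noteq> (m \<le> j \<and> rpar f = rpar g)) * A j *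
      (sgn (((m \<le> j) \<noteq> (m \<le> a)) \<and> (opar m w \<noteq> (m \<le> a))) * K j)"
  have "actb m n (vfield m f a) b b' = B a * single 1 w w' + (\<Sum>j<m + n. ?R j)"
    unfolding b b' actb_vfield xi_eq_contraction_wedge[OF okw] A_def B_def K_def ..
  moreover have "B a * single 1 w w' = (\<Sum>j<m + n. if a = j then B j * single 1 w w' else 0)"
    using a by simp
  moreover have "?L1 j + ?L2 j = (if a = j then B j * single 1 w w' else 0) + ?R j" for j
    by (cases "m \<le> a"; cases "m \<le> j"; cases "rpar f"; cases "rpar g"; cases "opar m w")
      (auto simp: sgn_def swap_sign_def algebra_simps)
  ultimately show ?thesis by (simp only: sum.distrib[symmetric])
qed

text \<open>The sum equals its own negative, which forces 0 in characteristic 0.\<close>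

lemma sum_antisym_zero:
  fixes T :: "'i \<Rightarrow> 'i \<Rightarrow> 'a::field_char_0"
  assumes "\<And>i j. T i j = - T j i"
  shows "(\<Sum>i\<in>A. \<Sum>j\<in>A. T i j) = 0"
proof -
  have "(\<Sum>i\<in>A. \<Sum>j\<in>A. T i j) = (\<Sum>j\<in>A. \<Sum>i\<in>A. T i j)" by (rule sum.swap)
  also have "\<dots> = - (\<Sum>i\<in>A. \<Sum>j\<in>A. T i j)"
    by (subst assms) (simp add: sum_negf)
  finally show ?thesis by (simp add: equal_neg_zero)
qed

text \<open>Exchanging the two indices costs \<open>- swap_sign\<close> from the derivations and
  \<open>swap_sign\<close> from the wedges, together -1, so the double sum is antisymmetric.\<close>

lemma ddb_ddb:
  fixes b' :: bas
  assumes "finite (snd (fst b))" "om_ok m (snd b)"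
  shows "lext (ddb m n) (ddb m n b) b' = (0 :: 'a::field_char_0)"
proof -
  obtain g w where b: "b = (g, w)" by (cases b)
  obtain g' w' where b': "b' = (g', w')" by (cases b')
  have fg: "finite (snd g)" and okw: "om_ok m w" using assms by (simp_all add: b)
  let ?q = "opar m w = rpar g"
  define T where "T = (\<lambda>j l. sgn (m \<le> j \<and> ?q) * sgn (m \<le> l \<and> ?q) *
     (single (dcoef m j g * dcoef m l (dmon m j g)) (dmon m l (dmon m j g)) g' *
      single (ocoef m w j * ocoef m (insort j w) l) (insort l (insort j w)) w') :: 'a)"
  have "lext (ddb m n) (ddb m n b) b' = (\<Sum>j<m + n. \<Sum>l<m + n. T j l)"
    unfolding b b' ddb_fun_eq[of m n g] lext_sum_single[OF finite_lessThan] ddb_eq sum_distrib_left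
  proof (intro sum.cong refl)
    fix j l
    let ?s = "sgn (m \<le> j \<and> ?q) :: 'a"
    let ?x = "?s * dcoef m j g * ocoef m w j * single
       (sgn (m \<le> l \<and> opar m (insort j w) = rpar (dmon m j g)) * dcoef m l (dmon m j g) * ocoef m (insort j w) l)
       (dmon m l (dmon m j g), insort l (insort j w)) (g', w')"
    show "?x = T j l"
    proof (cases "dcoef m j g = (0::'a)")
      case True
      then show ?thesis by (simp add: T_def)
    next
      case False
      have "(opar m (insort j w) = rpar (dmon m j g)) = ?q"
        unfolding rpar_dmon[OF fg False] opar_insort by auto
      then show ?thesis unfolding T_def single_Pair[symmetric]
        by (simp add: single_mult_left mult_ac)
    qed
  qed
  also have "\<dots> = 0"
  proof (rule sum_antisym_zero)
    fix j l
    show "T j l = - T l j"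
      unfolding T_def derivation_swap[OF fg, of m j l] wedge_swap[OF okw, of j l]
      by (simp add: swap_sign_sym[of m l j] mult_ac)
  qed
  finally show ?thesis .
qed

section \<open>The de Rham complex\<close>

lemma valid_om_iff: "valid_om m n k w \<longleftrightarrow> length w = k \<and> om_ok m w \<and> set w \<subseteq> {..<m + n}"
  by (auto simp: valid_om_def om_ok_def)

lemma valid_om_insort:
  "valid_om m n k w \<Longrightarrow> a < m + n \<Longrightarrow> \<not> (a < m \<and> a \<in> set w) \<Longrightarrow> valid_om m n (Suc k) (insort a w)"
  by (auto simp: valid_om_iff om_ok_insort set_insort_key)

lemma valid_om_remove1: "valid_om m n k w \<Longrightarrow> a \<in> set w \<Longrightarrow> valid_om m n (k - 1) (remove1 a w)"
  using notin_set_remove1 set_remove1_subset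
  by (fastforce simp: valid_om_iff om_ok_remove1 length_remove1)

lemma valid_rmon_finite: "valid_rmon m n g \<Longrightarrow> finite (snd g)"
  by (auto simp: valid_rmon_def intro: finite_subset)

lemma valid_rmon_dmon: "valid_rmon m n g \<Longrightarrow> valid_rmon m n (dmon m a g)"
  by (auto simp: valid_rmon_def dmon_def)

lemma valid_rmon_mmon: "valid_rmon m n f \<Longrightarrow> valid_rmon m n g \<Longrightarrow> valid_rmon m n (mmon f g)"
  by (auto simp: valid_rmon_def mmon_def)

lemma Vmod_fin_supp: "v \<in> Vmod m n k \<Longrightarrow> fin_supp v"
  by (simp add: Vmod_def)

lemma Vmod_valid:
  assumes "v \<in> Vmod m n k" "v b \<noteq> 0"
  shows "valid_rmon m n (fst b)" "valid_om m n k (snd b)" "finite (snd (fst b))" "om_ok m (snd b)"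
proof -
  show v: "valid_rmon m n (fst b)" "valid_om m n k (snd b)" using assms unfolding Vmod_def by blast+
  show "finite (snd (fst b))" "om_ok m (snd b)" using v by (simp_all add: valid_rmon_finite valid_om_iff)
qed

lemma Vmod_zero: "(\<lambda>_. 0) \<in> Vmod m n k"
  by (simp add: Vmod_def)

lemma Vmod_single:
  "(c \<noteq> 0 \<Longrightarrow> valid_rmon m n (fst b) \<and> valid_om m n k (snd b)) \<Longrightarrow> single c b \<in> Vmod m n k"
  unfolding Vmod_def by (simp add: fin_supp_single) (auto simp: single_def)

lemma Vmod_sum:
  assumes "finite A" "\<And>i. i \<in> A \<Longrightarrow> u i \<in> Vmod m n k"
  shows "(\<lambda>b. \<Sum>i\<in>A. u i b) \<in> Vmod m n k"
proof -
  have "fin_supp (\<lambda>b. \<Sum>i\<in>A. u i b)"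
    using assms by (intro fin_supp_sum Vmod_fin_supp)
  moreover have "valid_rmon m n (fst b) \<and> valid_om m n k (snd b)" if "(\<Sum>i\<in>A. u i b) \<noteq> 0" for b
    using sum_nonzero_ex[OF that] assms(2) Vmod_valid by blast
  ultimately show ?thesis unfolding Vmod_def by blast
qed

lemma Vmod_scale:
  fixes u :: "'a::comm_ring_1 vec"
  assumes "u \<in> Vmod m n k"
  shows "(\<lambda>b. h b * u b) \<in> Vmod m n k"
proof -
  have "fin_supp (\<lambda>b. h b * u b)" using Vmod_fin_supp[OF assms] by (rule rev_finite_subset) auto
  moreover have "u b \<noteq> 0" if "h b * u b \<noteq> 0" for b using that by auto
  ultimately show ?thesis using assms unfolding Vmod_def by blast
qed

lemma Vmod_add:
  assumes "u \<in> Vmod m n k" "v \<in> Vmod m n k"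
  shows "(\<lambda>b. u b + v b) \<in> Vmod m n k"
proof -
  have "finite ({b. u b \<noteq> 0} \<union> {b. v b \<noteq> 0})" using assms by (simp add: Vmod_fin_supp)
  then have "fin_supp (\<lambda>b. u b + v b)" by (rule rev_finite_subset) auto
  moreover have "u b \<noteq> 0 \<or> v b \<noteq> 0" if "u b + v b \<noteq> 0" for b using that by auto
  ultimately show ?thesis using assms unfolding Vmod_def by blast
qed

lemma Vmod_lext:
  fixes v :: "'a::comm_ring_1 vec"
  assumes "v \<in> Vmod m n k" "\<And>b. v b \<noteq> 0 \<Longrightarrow> F b \<in> Vmod m n l"
  shows "lext F v \<in> Vmod m n l"
  unfolding lext_def using assms by (intro Vmod_sum Vmod_scale) (auto simp: Vmod_fin_supp)

lemma ddb_in_Vmod: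
  assumes "valid_rmon m n (fst b)" "valid_om m n k (snd b)"
  shows "(ddb m n b :: 'a::comm_ring_1 vec) \<in> Vmod m n (Suc k)"
proof -
  obtain g w where b: "b = (g, w)" by (cases b)
  show ?thesis unfolding b ddb_fun_eq using assms unfolding b
    by (intro Vmod_sum Vmod_single) (auto intro!: valid_rmon_dmon valid_om_insort simp: ocoef_def split: if_splits)
qed

lemma dd_in_Vmod: "v \<in> Vmod m n k \<Longrightarrow> dd m n v \<in> Vmod m n (Suc k)" for v :: "'a::comm_ring_1 vec"
  unfolding dd_def by (rule Vmod_lext, assumption, rule ddb_in_Vmod) (auto dest: Vmod_valid)

definition iota :: "nat \<Rightarrow> rmon \<Rightarrow> nat \<Rightarrow> 'a::comm_ring_1 vec \<Rightarrow> 'a vec" where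
  "iota m f a = lext (iotab m f a)"

lemma iotab_in_Vmod:
  assumes "valid_rmon m n f" "valid_rmon m n (fst b)" "valid_om m n k (snd b)"
  shows "(iotab m f a b :: 'a::comm_ring_1 vec) \<in> Vmod m n (k - 1)"
proof (cases "icoef m a (snd b) = (0::'a)")
  case True
  then show ?thesis unfolding iotab_def by (intro Vmod_single) simp
next
  case False
  then show ?thesis unfolding iotab_def using assms
    by (intro Vmod_single) (auto intro!: valid_rmon_mmon valid_om_remove1 dest: icoef_nonzero_in simp del: One_nat_def)
qed

lemma iota_in_Vmod:
  "valid_rmon m n f \<Longrightarrow> v \<in> Vmod m n k \<Longrightarrow> iota m f a v \<in> Vmod m n (k - 1)" for v :: "'a::comm_ring_1 vec"
  unfolding iota_def by (rule Vmod_lext, assumption, rule iotab_in_Vmod) (auto dest: Vmod_valid)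

lemma iota_Vmod_0: "v \<in> Vmod m n 0 \<Longrightarrow> iota m f a v = (\<lambda>_. 0)" for v :: "'a::comm_ring_1 vec"
  by (auto simp: fun_eq_iff iota_def lext_def iotab_def icoef_def valid_om_iff dest!: Vmod_valid(2) intro!: sum.neutral)

lemma cartan:
  fixes v :: "'a::comm_ring_1 vec"
  assumes v: "v \<in> Vmod m n k" and f: "valid_rmon m n f" and a: "a < m + n"
  shows "actv m n (vfield m f a) v = (\<lambda>b. dd m n (iota m f a v) b + iota m f a (dd m n v) b)"
proof
  fix b'
  note fin = Vmod_fin_supp[OF v]
  have "actv m n (vfield m f a) v b'
      = lext (\<lambda>b b'. lext (ddb m n) (iotab m f a b) b' + lext (iotab m f a) (ddb m n b) b') v b'"
    unfolding actv_def using Vmod_valid[OF v] f a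
    by (intro lext_cong cartan_basis) (auto dest: valid_rmon_finite)
  also have "\<dots> = lext (\<lambda>b. lext (ddb m n) (iotab m f a b)) v b' + lext (\<lambda>b. lext (iotab m f a) (ddb m n b)) v b'"
    by (simp add: lext_def[of _ v] distrib_left sum.distrib)
  also have "lext (\<lambda>b. lext (ddb m n) (iotab m f a b)) v b' = dd m n (iota m f a v) b'"
    unfolding dd_def iota_def
    by (rule lext_lext[symmetric, OF fin]) (simp add: iotab_def fin_supp_single)
  also have "lext (\<lambda>b. lext (iotab m f a) (ddb m n b)) v b' = iota m f a (dd m n v) b'"
    unfolding dd_def iota_def
    by (rule lext_lext[symmetric, OF fin], rule Vmod_fin_supp, rule ddb_in_Vmod)
      (auto dest: Vmod_valid[OF v])
  finally show "actv m n (vfield m f a) v b' = dd m n (iota m f a v) b' + iota m f a (dd m n v) b'" .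
qed

lemma dd_dd:
  fixes v :: "'a::field_char_0 vec"
  assumes v: "v \<in> Vmod m n k"
  shows "dd m n (dd m n v) = (\<lambda>_. 0)"
proof
  fix b'
  have "dd m n (dd m n v) b' = lext (\<lambda>b. lext (ddb m n) (ddb m n b)) v b'"
    unfolding dd_def by (rule lext_lext[OF Vmod_fin_supp[OF v]], rule Vmod_fin_supp, rule ddb_in_Vmod)
      (auto dest: Vmod_valid[OF v])
  also have "\<dots> = lext (\<lambda>_ _. 0) v b'"
    using Vmod_valid[OF v] by (intro lext_cong ddb_ddb) auto
  finally show "dd m n (dd m n v) b' = 0" by (simp add: lext_def)
qed

lemma dd_zero [simp]: "dd m n (\<lambda>_. 0) = (\<lambda>_. 0)"
  by (simp add: dd_def)

lemma iota_zero [simp]: "iota m f a (\<lambda>_. 0) = (\<lambda>_. 0)"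
  by (simp add: iota_def)

lemma dd_add:
  "u \<in> Vmod m n k \<Longrightarrow> v \<in> Vmod m n k \<Longrightarrow> dd m n (\<lambda>b. u b + v b) = (\<lambda>b. dd m n u b + dd m n v b)"
  unfolding dd_def using lext_add[OF Vmod_fin_supp Vmod_fin_supp] by blast

lemma dd_scale: "u \<in> Vmod m n k \<Longrightarrow> dd m n (\<lambda>b. c * u b) = (\<lambda>b. c * dd m n u b)"
  unfolding dd_def using lext_scale[OF Vmod_fin_supp] by blast

lemma dd_iota_in_Vmod:
  fixes v :: "'a::comm_ring_1 vec"
  assumes f: "valid_rmon m n f" and v: "v \<in> Vmod m n k"
  shows "dd m n (iota m f a v) \<in> Vmod m n k"
proof (cases k)
  \<comment> \<open>Here \<open>Suc (k - 1)\<close> differs from \<open>k\<close> by truncation, but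
    the contraction itself vanishes.\<close>
  case 0
  then have "iota m f a v = (\<lambda>_. 0)" using v iota_Vmod_0 by blast
  then show ?thesis by (simp add: Vmod_zero)
next
  case (Suc l)
  then show ?thesis using dd_in_Vmod[OF iota_in_Vmod[OF f v]] by simp
qed

text \<open>Follows from the Cartan formula, since \<open>d\<close> raises and contraction lowers
  the form degree by one.\<close>

lemma actv_in_Vmod:
  fixes v :: "'a::comm_ring_1 vec"
  assumes v: "v \<in> Vmod m n k" and X: "valid_vf m n X"
  shows "actv m n X v \<in> Vmod m n k"
proof -
  obtain f a where X': "X = vfield m f a" and f: "valid_rmon m n f" and a: "a < m + n"
    using X by (rule valid_vfE)
  have "dd m n (iota m f a v) \<in> Vmod m n k" by (rule dd_iota_in_Vmod[OF f v])
  moreover have "iota m f a (dd m n v) \<in> Vmod m n k"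
    using iota_in_Vmod[OF f dd_in_Vmod[OF v]] by simp
  ultimately show ?thesis
    unfolding X' cartan[OF v f a] by (rule Vmod_add)
qed

text \<open>By the Cartan formula and \<open>d d = 0\<close>, both sides reduce to
  \<open>d iota d\<close>.\<close>

lemma dd_actv:
  fixes v :: "'a::field_char_0 vec"
  assumes v: "v \<in> Vmod m n k" and X: "valid_vf m n X"
  shows "dd m n (actv m n X v) = actv m n X (dd m n v)"
proof -
  obtain f a where X': "X = vfield m f a" and f: "valid_rmon m n f" and a: "a < m + n"
    using X by (rule valid_vfE)
  have i: "iota m f a v \<in> Vmod m n (k - 1)" using iota_in_Vmod[OF f v] .
  have di: "dd m n (iota m f a v) \<in> Vmod m n k" by (rule dd_iota_in_Vmod[OF f v])
  have id: "iota m f a (dd m n v) \<in> Vmod m n k"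
    using iota_in_Vmod[OF f dd_in_Vmod[OF v]] by simp
  show ?thesis
    unfolding X' cartan[OF v f a] cartan[OF dd_in_Vmod[OF v] f a] dd_add[OF di id] dd_dd[OF i] dd_dd[OF v]
    by simp
qed

text \<open>An operator that preserves a grading commutes with rescaling the graded pieces; the
  parity projection and division by the total degree are the instances used.\<close>

lemma lext_weight:
  fixes v :: "'a::comm_ring_1 vec"
  assumes "fin_supp v" "\<And>b b'. v b \<noteq> 0 \<Longrightarrow> F b b' \<noteq> 0 \<Longrightarrow> h b = h b'"
  shows "lext F (\<lambda>b. h b * v b) = (\<lambda>b'. h b' * lext F v b')"
proof
  fix b'
  have "lext F (\<lambda>b. h b * v b) b' = (\<Sum>b | v b \<noteq> 0. h b * v b * F b b')"
    by (rule lext_superset[OF assms(1)]) auto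
  also have "\<dots> = (\<Sum>b | v b \<noteq> 0. h b' * (v b * F b b'))"
    using assms(2) by (intro sum.cong refl) (metis mem_Collect_eq mult.assoc mult_zero_right)
  finally show "lext F (\<lambda>b. h b * v b) b' = h b' * lext F v b'"
    by (simp add: lext_def sum_distrib_left)
qed

lemma evpart_eq_scale: "evpart m u = (\<lambda>b. (if bpar m b then 0 else 1) * u b)"
  by (auto simp: evpart_def)

lemma evpart_in_Vmod: "u \<in> Vmod m n k \<Longrightarrow> evpart m u \<in> Vmod m n k" for u :: "'a::comm_ring_1 vec"
  unfolding evpart_eq_scale by (rule Vmod_scale)

section \<open>Parity and total degree under the differential\<close>

definition rdeg :: "nat \<Rightarrow> rmon \<Rightarrow> nat" where
  "rdeg m g = (\<Sum>i<m. fst g i) + card (snd g)"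

lemma rdeg_dmon:
  assumes "finite (snd g)" "dcoef m a g \<noteq> (0::'a::comm_ring_1)"
  shows "rdeg m g = Suc (rdeg m (dmon m a g))"
proof (cases "a < m")
  case True
  then have pos: "fst g a > 0" using assms by (auto simp: dcoef_def intro: ccontr)
  have "(\<Sum>i<m. fst g i) = fst g a + (\<Sum>i\<in>{..<m} - {a}. fst g i)"
    using True by (subst sum.remove[of _ a]) auto
  moreover have "(\<Sum>i<m. ((fst g)(a := fst g a - 1)) i) = fst g a - 1 + (\<Sum>i\<in>{..<m} - {a}. fst g i)"
    using True by (subst sum.remove[of _ a]) (auto intro!: sum.cong)
  ultimately show ?thesis using pos True by (simp add: rdeg_def dmon_def)
next
  case False
  then show ?thesis using assms card_Suc_Diff1[of "snd g" "a - m"]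
    by (auto simp: rdeg_def dmon_def dcoef_def split: if_splits)
qed

lemma ddb_nonzeroE:
  assumes "ddb m n (g, w) b' \<noteq> (0::'a::comm_ring_1)"
  obtains a where "a < m + n" "dcoef m a g \<noteq> (0::'a)" "b' = (dmon m a g, insort a w)"
proof -
  obtain a where "a < m + n" and nz: "single (sgn (m \<le> a \<and> opar m w = rpar g) * dcoef m a g * ocoef m w a) (dmon m a g, insort a w) b' \<noteq> (0::'a)"
    using assms unfolding ddb_eq by (auto dest!: sum_nonzero_ex)
  moreover from nz have "dcoef m a g \<noteq> (0::'a)" "b' = (dmon m a g, insort a w)"
    by (auto simp: single_def split: if_splits)
  ultimately show ?thesis using that by blast
qed

lemma dd_evpart:
  fixes v :: "'a::comm_ring_1 vec"
  assumes v: "v \<in> Vmod m n k"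
  shows "dd m n (evpart m v) = evpart m (dd m n v)"
  unfolding evpart_eq_scale dd_def
proof (rule lext_weight[OF Vmod_fin_supp[OF v]])
  fix b b' assume "v b \<noteq> 0" and nz: "ddb m n b b' \<noteq> (0::'a)"
  obtain g w where b: "b = (g, w)" by (cases b)
  have fg: "finite (snd g)" using Vmod_valid(3)[OF v \<open>v b \<noteq> 0\<close>] b by simp
  obtain a where "dcoef m a g \<noteq> (0::'a)" "b' = (dmon m a g, insort a w)"
    using nz unfolding b by (rule ddb_nonzeroE)
  then have "bpar m b = bpar m b'" by (auto simp: bpar_def b rpar_dmon[OF fg] opar_insort)
  then show "(if bpar m b then 0 else 1) = (if bpar m b' then 0 else 1 :: 'a)" by simp
qed

definition bdeg :: "nat \<Rightarrow> bas \<Rightarrow> nat" where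
  "bdeg m b = rdeg m (fst b) + length (snd b)"

text \<open>Each term of \<open>d\<close> removes one variable and adds one form factor, so the
  total degree is kept. The Poincare lemma takes \<open>h\<close> to be the inverse of the
  degree.\<close>

lemma dd_bdeg_weight:
  fixes v :: "'a::comm_ring_1 vec"
  assumes v: "v \<in> Vmod m n k"
  shows "dd m n (\<lambda>b. h (bdeg m b) * v b) = (\<lambda>b. h (bdeg m b) * dd m n v b)"
  unfolding dd_def
proof (rule lext_weight[OF Vmod_fin_supp[OF v]])
  fix b b' assume "v b \<noteq> 0" and nz: "ddb m n b b' \<noteq> (0::'a)"
  obtain g w where b: "b = (g, w)" by (cases b)
  have fg: "finite (snd g)" using Vmod_valid(3)[OF v \<open>v b \<noteq> 0\<close>] b by simp
  obtain a where "dcoef m a g \<noteq> (0::'a)" "b' = (dmon m a g, insort a w)"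
    using nz unfolding b by (rule ddb_nonzeroE)
  then have "bdeg m b = bdeg m b'" by (simp add: bdeg_def b rdeg_dmon[OF fg])
  then show "h (bdeg m b) = h (bdeg m b')" by simp
qed

section \<open>Euler fields and the Poincare lemma\<close>

definition rone :: rmon where "rone = (\<lambda>_. 0, {})"

definition xvar :: "nat \<Rightarrow> nat \<Rightarrow> rmon" where
  "xvar m a = (if a < m then ((\<lambda>_. 0)(a := 1), {}) else (\<lambda>_. 0, {a - m}))"

lemma valid_rmon_rone: "valid_rmon m n rone"
  by (simp add: valid_rmon_def rone_def)

lemma valid_rmon_xvar: "a < m + n \<Longrightarrow> valid_rmon m n (xvar m a)"
  by (auto simp: valid_rmon_def xvar_def)

lemma dcoef_rone [simp]: "dcoef m a rone = 0"
  by (simp add: dcoef_def rone_def)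

lemma dcoef_xvar: "dcoef m j (xvar m a) = (if j = a then 1 else 0)"
proof -
  have e: "{s. s = x \<and> s < x} = {}" for x :: nat by auto
  show ?thesis by (auto simp: dcoef_def xvar_def e)
qed

lemma minus_one_power_nonzero [simp]: "(- 1) ^ k \<noteq> (0::'a::comm_ring_1)"
  using minus_one_power_square[of k "1::'a"] by (metis mult_zero_left zero_neq_one)

lemma dmon_xvar: "dmon m a (xvar m a) = rone"
  by (auto simp: dmon_def xvar_def rone_def)

lemma mcoef_rone [simp]: "mcoef rone g = 1" "mcoef g rone = 1"
  by (auto simp: mcoef_def rone_def isign_def)

lemma mmon_rone [simp]: "mmon rone g = g" "mmon g rone = g"
  by (auto simp: mmon_def rone_def)

lemma rpar_rone [simp]: "\<not> rpar rone"
  by (simp add: rpar_def rone_def)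

lemma rpar_xvar: "rpar (xvar m a) = (m \<le> a)"
  by (simp add: rpar_def xvar_def)

definition var_deg :: "nat \<Rightarrow> nat \<Rightarrow> rmon \<Rightarrow> nat" where
  "var_deg m a g = (if a < m then fst g a else if a - m \<in> snd g then 1 else 0)"

lemma var_deg_rone [simp]: "var_deg m a rone = 0"
  by (simp add: var_deg_def rone_def)

lemma xvar_derivation:
  assumes "finite (snd g)"
  shows "single (dcoef m a g * mcoef (xvar m a) (dmon m a g)) (mmon (xvar m a) (dmon m a g)) g'
    = single (of_nat (var_deg m a g) :: 'a::comm_ring_1) g g'"
proof (cases "dcoef m a g = (0::'a)")
  case True
  show ?thesis
  proof (cases "a < m")
    case True
    with \<open>dcoef m a g = 0\<close> show ?thesis by (simp add: var_deg_def dcoef_def)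
  next
    case False
    with \<open>dcoef m a g = 0\<close> have "a - m \<notin> snd g" by (auto simp: dcoef_def)
    with False \<open>dcoef m a g = 0\<close> show ?thesis by (simp add: var_deg_def)
  qed
next
  case False
  show ?thesis
  proof (cases "a < m")
    case True
    then have "fst g a \<noteq> 0" using False by (auto simp: dcoef_def intro: ccontr)
    then have "mmon (xvar m a) (dmon m a g) = g"
      using True by (intro prod_eqI) (auto simp: mmon_def xvar_def dmon_def)
    moreover have "mcoef (xvar m a) (dmon m a g) = (1::'a)"
      using True by (simp add: mcoef_def xvar_def isign_def)
    ultimately show ?thesis using True by (simp add: dcoef_def var_deg_def)
  next
    case F: False
    define s where "s = a - m"
    have s: "s \<in> snd g" using False F by (auto simp: dcoef_def s_def split: if_splits)
    then have "mmon (xvar m a) (dmon m a g) = g"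
      using F by (intro prod_eqI) (auto simp: mmon_def xvar_def dmon_def s_def)
    \<comment> \<open>Multiplying by \<open>y_s\<close> from the left costs the same sign as
      differentiating it away, so the two signs cancel.\<close>
    moreover have "isign {s} (snd g - {s}) = ((- 1) ^ card {t \<in> snd g. t < s} :: 'a)"
    proof -
      have "{(c, b). c \<in> {s} \<and> b \<in> snd g - {s} \<and> b < c} = Pair s ` {t \<in> snd g. t < s}" by auto
      moreover have "card (Pair s ` {t \<in> snd g. t < s}) = card {t \<in> snd g. t < s}"
        by (rule card_image) (simp add: inj_on_def)
      ultimately show ?thesis by (simp add: isign_def)
    qed
    ultimately show ?thesis using F s minus_one_power_square[of _ "1::'a"]
      by (simp add: dcoef_def var_deg_def mcoef_def xvar_def dmon_def s_def[symmetric])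
  qed
qed

text \<open>The number operator of Omega(V): the signs for taking \<open>e_a\<close> out and putting
  it back cancel and leave the multiplicity.\<close>

lemma wedge_contraction_same:
  assumes "om_ok m w"
  shows "single (icoef m a w * ocoef m (remove1 a w) a) (insort a (remove1 a w)) u
    = single (of_nat (count (mset w) a) :: 'a::comm_ring_1) w u"
proof (cases "a \<in> set w")
  case True
  have r: "insort a (remove1 a w) = w" using True om_ok_sorted[OF assms]
    by (intro sorted_eqI) (auto simp: sorted_insort sorted_remove1)
  have "\<not> (a < m \<and> a \<in> set (remove1 a w))"
  proof
    assume *: "a < m \<and> a \<in> set (remove1 a w)"
    then have "count (mset (remove1 a w)) a = 1" "count (mset w) a = 1"
      using om_ok_count assms om_ok_remove1[OF assms] True by (metis)+
    then show False by simp
  qed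
  then have "ocoef m (remove1 a w) a = (osign m a w :: 'a)"
    unfolding ocoef_def using True by (simp only: if_False osign_remove1' less_irrefl mult_1_right)
  then show ?thesis unfolding r by (simp add: icoef_def mult.assoc)
next
  case False
  then have "count (mset w) a = 0" by simp
  then show ?thesis unfolding icoef_def by (simp only: of_nat_0 mult_zero_left single_zero)
qed

text \<open>A linear coefficient has a single nonzero derivative, so only the term
  \<open>j = c\<close> of the gl-part survives.\<close>

lemma actb_xvar:
  assumes "c < m + n"
  shows "actb m n (vfield m (xvar m c) a) (g, w) (g', w')
   = single (dcoef m a g * mcoef (xvar m c) (dmon m a g)) (mmon (xvar m c) (dmon m a g)) g' * single 1 w w'
     + sgn ((m \<le> a \<and> rpar g) \<noteq> (m \<le> c \<and> (m \<le> c) = rpar g)) * single 1 g g' * xi m c a w w'"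
proof -
  let ?t = "\<lambda>j. sgn ((m \<le> a \<and> rpar g) \<noteq> (m \<le> j \<and> rpar (xvar m c) = rpar g)) *
          single (dcoef m j (xvar m c) * mcoef (dmon m j (xvar m c)) g) (mmon (dmon m j (xvar m c)) g) g' * xi m j a w w'"
  have "(\<Sum>j<m + n. ?t j) = ?t c"
    using assms by (subst sum.remove[of _ c]) (auto simp: dcoef_xvar)
  then show ?thesis
    unfolding actb_vfield by (simp add: dcoef_xvar dmon_xvar rpar_xvar)
qed

lemma actb_euler:
  assumes "c < m + n" "finite (snd (fst b))" "om_ok m (snd b)"
  shows "actb m n (vfield m (xvar m c) c) b b'
    = single (of_nat (var_deg m c (fst b) + count (mset (snd b)) c) :: 'a::comm_ring_1) b b'"
proof -
  obtain g w where b: "b = (g, w)" by (cases b)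
  obtain g' w' where b': "b' = (g', w')" by (cases b')
  have "sgn ((m \<le> c \<and> rpar g) \<noteq> (m \<le> c \<and> (m \<le> c) = rpar g)) = (1::'a)"
    by (auto simp: sgn_def)
  then show ?thesis using assms unfolding b b'
    by (simp add: actb_xvar xvar_derivation xi_eq_contraction_wedge wedge_contraction_same sgn_def)
      (simp add: single_def)
qed

text \<open>These fields form the torus; the scalars are the weights that separate constant
  monomials, and their sum over \<open>c\<close> is the total degree.\<close>

lemma actv_euler:
  fixes v :: "'a::comm_ring_1 vec"
  assumes v: "v \<in> Vmod m n k" and c: "c < m + n"
  shows "actv m n (vfield m (xvar m c) c) v
    = (\<lambda>b. of_nat (var_deg m c (fst b) + count (mset (snd b)) c) * v b)"
proof
  fix b'
  let ?h = "\<lambda>b. of_nat (var_deg m c (fst b) + count (mset (snd b)) c) :: 'a"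
  have "actv m n (vfield m (xvar m c) c) v b' = lext (\<lambda>b. single (?h b) b) v b'"
    unfolding actv_def using Vmod_valid[OF v] c by (intro lext_cong actb_euler) auto
  also have "\<dots> = (\<Sum>b\<in>insert b' {b. v b \<noteq> 0}. v b * single (?h b) b b')"
    by (rule lext_superset) (auto simp: Vmod_fin_supp[OF v])
  also have "\<dots> = (\<Sum>b\<in>insert b' {b. v b \<noteq> 0}. if b = b' then ?h b * v b else 0)"
    by (intro sum.cong) (auto simp: single_def)
  also have "\<dots> = ?h b' * v b'" using Vmod_fin_supp[OF v] by (subst sum.delta) auto
  finally show "actv m n (vfield m (xvar m c) c) v b' = ?h b' * v b'" .
qed

section \<open>Constant vector fields\<close>

lemma actb_partial: "actb m n (vfield m rone a) (g, w) b' = single (dcoef m a g :: 'a::comm_ring_1) (dmon m a g, w) b'"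
  by (cases b') (auto simp: actb_vfield single_def)

lemma actv_partial_nonzeroE:
  fixes v :: "'a::comm_ring_1 vec"
  assumes "actv m n (vfield m rone a) v b' \<noteq> 0"
  obtains g w where "v (g, w) \<noteq> 0" "dcoef m a g \<noteq> (0::'a)" "b' = (dmon m a g, w)"
proof -
  obtain b where "v b \<noteq> 0" "v b * actb m n (vfield m rone a) b b' \<noteq> 0"
    using assms unfolding actv_def lext_def by (auto dest!: sum_nonzero_ex)
  moreover obtain g w where "b = (g, w)" by (cases b)
  ultimately have "v (g, w) \<noteq> 0" "dcoef m a g \<noteq> (0::'a)" "b' = (dmon m a g, w)"
    by (auto simp: actb_partial single_def split: if_splits)
  then show ?thesis using that by blast
qed

text \<open>A nonzero coefficient means that the variable was present, so it can be restored. Hence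
  a partial derivative never cancels contributions of different monomials.\<close>

lemma dmon_inj:
  assumes "dcoef m a g \<noteq> (0::'a::comm_ring_1)" "dcoef m a h \<noteq> (0::'a)" "dmon m a g = dmon m a h"
  shows "g = h"
proof (cases "a < m")
  case True
  have "fst g a \<noteq> 0" "fst h a \<noteq> 0" using assms True by (auto simp: dcoef_def intro: ccontr)
  moreover have eq: "(fst g)(a := fst g a - 1) = (fst h)(a := fst h a - 1)" "snd g = snd h"
    using assms(3) True by (auto simp: dmon_def)
  moreover have "(if i = a then fst g a - 1 else fst g i) = (if i = a then fst h a - 1 else fst h i)" for i
    using fun_cong[OF eq(1), of i] by (simp only: fun_upd_def)
  ultimately have "fst g i = fst h i" for i
    by (metis One_nat_def Suc_pred neq0_conv)
  then show ?thesis using eq(2) by (auto intro: prod_eqI)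
next
  case False
  have "a - m \<in> snd g" "a - m \<in> snd h" using assms False by (auto simp: dcoef_def split: if_splits)
  moreover have "fst g = fst h" "snd g - {a - m} = snd h - {a - m}"
    using assms(3) False by (auto simp: dmon_def)
  ultimately show ?thesis by (auto intro: prod_eqI)
qed

lemma actv_partial_apply:
  fixes v :: "'a::comm_ring_1 vec"
  assumes "fin_supp v" "dcoef m a g \<noteq> (0::'a)"
  shows "actv m n (vfield m rone a) v (dmon m a g, w) = v (g, w) * dcoef m a g"
proof -
  let ?B = "insert (g, w) {b. v b \<noteq> 0}"
  have "actv m n (vfield m rone a) v (dmon m a g, w)
      = (\<Sum>b\<in>?B. v b * actb m n (vfield m rone a) b (dmon m a g, w))"
    unfolding actv_def by (rule lext_superset) (use assms in auto)
  also have "\<dots> = (\<Sum>b\<in>?B. if b = (g, w) then v b * dcoef m a g else 0)"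
  proof (rule sum.cong)
    fix b :: bas
    obtain h u where "b = (h, u)" by (cases b)
    then show "v b * actb m n (vfield m rone a) b (dmon m a g, w) = (if b = (g, w) then v b * dcoef m a g else 0)"
      using dmon_inj[OF assms(2), of h] by (cases "dcoef m a h = (0::'a)") (auto simp: actb_partial single_def assms(2))
  qed simp
  also have "\<dots> = v (g, w) * dcoef m a g" using assms(1) by (subst sum.delta) auto
  finally show ?thesis .
qed

lemma ex_dcoef_nonzero:
  assumes "valid_rmon m n g" "g \<noteq> rone"
  obtains a where "a < m + n" "dcoef m a g \<noteq> (0::'a::field_char_0)"
proof -
  have "(\<exists>i<m. fst g i \<noteq> 0) \<or> snd g \<noteq> {}"
  proof (rule ccontr)
    assume "\<not> ?thesis"
    then have "fst g i = 0" for i using assms(1) by (cases "i < m") (auto simp: valid_rmon_def)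
    with \<open>\<not> ?thesis\<close> have "g = rone" by (intro prod_eqI) (auto simp: rone_def)
    with assms(2) show False ..
  qed
  then show ?thesis
  proof
    assume "\<exists>i<m. fst g i \<noteq> 0"
    then obtain i where "i < m" "fst g i \<noteq> 0" by blast
    then show ?thesis by (intro that[of i]) (auto simp: dcoef_def)
  next
    assume "snd g \<noteq> {}"
    then obtain s where s: "s \<in> snd g" by blast
    then have "s < n" using assms(1) by (auto simp: valid_rmon_def)
    with s show ?thesis by (intro that[of "m + s"]) (auto simp: dcoef_def)
  qed
qed

lemma sum_var_deg:
  assumes "valid_rmon m n g"
  shows "(\<Sum>a<m + n. var_deg m a g) = rdeg m g"
proof -
  have "(\<Sum>i<n. var_deg m (m + i) g) = (\<Sum>i<n. if i \<in> snd g then 1 else 0)"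
    by (intro sum.cong) (auto simp: var_deg_def)
  also have "\<dots> = card (snd g)"
    using assms by (simp add: sum.If_cases valid_rmon_def Int_absorb1)
  finally show ?thesis by (simp add: sum_lessThan_add rdeg_def var_deg_def)
qed

lemma sum_count_mset:
  fixes N :: nat
  assumes "set w \<subseteq> {..<N}"
  shows "(\<Sum>a<N. count (mset w) a) = length w"
proof -
  have "(\<Sum>a<N. count (mset w) a) = (\<Sum>a\<in>set_mset (mset w). count (mset w) a)"
    using assms by (intro sum.mono_neutral_right) (auto simp: count_eq_zero_iff)
  also have "\<dots> = length w"
    by (simp only: size_multiset_overloaded_eq[symmetric] size_mset)
  finally show ?thesis .
qed

text \<open>Poincare lemma: by the Cartan formula the Euler field \<open>E\<close> acts on closed forms as
  \<open>d \<iota>\<^sub>E\<close>, and it acts on \<open>x\<^sup>\<alpha> y\<^sub>\<eta> \<otimes> w\<close> by the positive scalar \<open>|\<alpha>| + |\<eta>| + |w|\<close>.\<close>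

lemma closed_imp_exact:
  fixes v :: "'a::field_char_0 vec"
  assumes v: "v \<in> Vmod m n (Suc k)" and closed: "dd m n v = (\<lambda>_. 0)"
  shows "v \<in> dd m n ` Vmod m n k"
proof -
  \<comment> \<open>Dividing by the Euler eigenvalue beforehand makes the differential of the
    contracted form equal to \<open>v\<close> itself.\<close>
  define v' where "v' = (\<lambda>b. inverse (of_nat (bdeg m b)) * v b)"
  have v': "v' \<in> Vmod m n (Suc k)" unfolding v'_def by (rule Vmod_scale[OF v])
  have d: "dd m n v' = (\<lambda>_. 0)"
    unfolding v'_def using dd_bdeg_weight[OF v, of "\<lambda>d. inverse (of_nat d)"] closed by simp
  let ?i = "\<lambda>a. iota m (xvar m a) a v'"
  have i: "?i a \<in> Vmod m n k" if "a < m + n" for a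
    using iota_in_Vmod[OF valid_rmon_xvar[OF that] v'] by simp
  have di: "dd m n (?i a) b = of_nat (var_deg m a (fst b) + count (mset (snd b)) a) * v' b" if "a < m + n" for a b
    using fun_cong[OF cartan[OF v' valid_rmon_xvar[OF that] that], of b]
    by (simp add: d actv_euler[OF v' that])
  have eq: "dd m n (\<lambda>b. \<Sum>a<m + n. ?i a b) = v"
  proof
    fix b
    have "dd m n (\<lambda>b. \<Sum>a<m + n. ?i a b) b = (\<Sum>a<m + n. dd m n (?i a) b)"
      unfolding dd_def using i by (intro lext_sum Vmod_fin_supp) auto
    also have "\<dots> = of_nat (\<Sum>a<m + n. var_deg m a (fst b) + count (mset (snd b)) a) * v' b"
      by (simp add: di sum_distrib_right)
    also have "\<dots> = v b"
    proof (cases "v b = 0")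
      case True
      then show ?thesis by (simp add: v'_def)
    next
      case False
      note vb = Vmod_valid[OF v False]
      have "(\<Sum>a<m + n. var_deg m a (fst b) + count (mset (snd b)) a) = bdeg m b"
        using vb by (simp only: sum.distrib sum_var_deg sum_count_mset valid_om_iff bdeg_def)
      \<comment> \<open>The form part has length \<open>Suc k\<close>, so the degree is positive and
        \<open>inverse\<close> is a genuine inverse in characteristic 0.\<close>
      moreover have "bdeg m b \<noteq> 0" using vb by (auto simp: bdeg_def valid_om_iff)
      ultimately show ?thesis by (simp add: v'_def)
    qed
    finally show "dd m n (\<lambda>b. \<Sum>a<m + n. ?i a b) b = v b" .
  qed
  have "(\<lambda>b. \<Sum>a<m + n. ?i a b) \<in> Vmod m n k" using i by (intro Vmod_sum) auto
  from imageI[OF this, of "dd m n"] show ?thesis unfolding eq .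
qed

lemma image_dd_eq_kernel:
  "dd m n ` (Vmod m n k :: 'a::field_char_0 vec set) = {v \<in> Vmod m n (Suc k). dd m n v = (\<lambda>_. 0)}"
  by (intro equalityI subsetI) (auto simp: closed_imp_exact dd_in_Vmod dd_dd)

section \<open>Submodules\<close>

definition constants :: "nat \<Rightarrow> nat \<Rightarrow> nat \<Rightarrow> 'a::comm_ring_1 vec set" where
  "constants m n k = {v \<in> Vmod m n k. \<forall>b. v b \<noteq> 0 \<longrightarrow> fst b = rone}"

lemma Lmod_eq: "Lmod m n k = \<Inter>{S. submod m n k S \<and> constants m n k \<subseteq> S}"
  by (simp add: Lmod_def constants_def rone_def)

lemma submodD:
  assumes "submod m n k S"
  shows "S \<subseteq> Vmod m n k" "(\<lambda>_. 0) \<in> S"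
    "u \<in> S \<Longrightarrow> v \<in> S \<Longrightarrow> (\<lambda>b. u b + v b) \<in> S" "u \<in> S \<Longrightarrow> (\<lambda>b. c * u b) \<in> S"
    "u \<in> S \<Longrightarrow> evpart m u \<in> S" "u \<in> S \<Longrightarrow> valid_vf m n X \<Longrightarrow> actv m n X u \<in> S"
  using assms unfolding submod_def by blast+

lemma submod_sum:
  assumes S: "submod m n k S" and "finite A" "\<And>i. i \<in> A \<Longrightarrow> u i \<in> S"
  shows "(\<lambda>b. \<Sum>i\<in>A. u i b) \<in> S"
  using assms(2,3)
proof (induction A rule: finite_induct)
  case empty
  then show ?case using submodD(2)[OF S] by simp
next
  case (insert i A)
  then show ?case using submodD(3)[OF S, of "u i" "\<lambda>b. \<Sum>i\<in>A. u i b"] by simp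
qed

lemma submod_lext:
  assumes S: "submod m n k S" and "fin_supp v" "\<And>b. v b \<noteq> 0 \<Longrightarrow> F b \<in> S"
  shows "lext F v \<in> S"
  unfolding lext_def using assms(2,3) by (intro submod_sum[OF S] submodD(4)[OF S]) auto

lemma lext_single_self:
  fixes v :: "'a::comm_ring_1 vec"
  assumes "fin_supp v"
  shows "lext (single 1) v = v"
proof
  fix b'
  have "lext (single 1) v b' = (\<Sum>b\<in>insert b' {b. v b \<noteq> 0}. v b * single 1 b b')"
    using assms by (intro lext_superset) auto
  also have "\<dots> = (\<Sum>b\<in>insert b' {b. v b \<noteq> 0}. if b = b' then v b else 0)"
    by (intro sum.cong) (auto simp: single_def)
  also have "\<dots> = v b'" using assms by (subst sum.delta) auto
  finally show "lext (single 1) v b' = v b'" .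
qed

lemma submod_single_scale:
  assumes S: "submod m n k S" and "single c b \<in> S" "c \<noteq> 0"
  shows "single (1::'a::field) b \<in> S"
proof -
  have "(\<lambda>b'. inverse c * single c b b') = single 1 b" using assms(3) by (auto simp: single_def)
  then show ?thesis using submodD(4)[OF S assms(2), of "inverse c"] by simp
qed

text \<open>A nonzero element with the least bound on its polynomial degree must be constant:
  otherwise a partial derivative yields a nonzero element of \<open>S\<close> with a smaller
  bound.\<close>

lemma submod_has_constant:
  fixes S :: "'a::field_char_0 vec set"
  assumes S: "submod m n k S" and u: "u \<in> S" "u \<noteq> (\<lambda>_. 0)"
  obtains v where "v \<in> S" "v \<noteq> (\<lambda>_. 0)" "v \<in> constants m n k"
proof -
  define P where "P N \<longleftrightarrow> (\<exists>u\<in>S. u \<noteq> (\<lambda>_. 0) \<and> (\<forall>b. u b \<noteq> 0 \<longrightarrow> rdeg m (fst b) \<le> N))" for N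
  have "P (Max ((\<lambda>b. rdeg m (fst b)) ` {b. u b \<noteq> 0}))"
    unfolding P_def
  proof (intro bexI[of _ u] conjI allI impI u Max_ge)
    show "finite ((\<lambda>b. rdeg m (fst b)) ` {b. u b \<noteq> 0})"
      using u(1) submodD(1)[OF S] by (intro finite_imageI Vmod_fin_supp[of u m n k]) blast
  qed (rule imageI, simp)
  then have "P (LEAST N. P N)" by (rule LeastI)
  then obtain v where v: "v \<in> S" "v \<noteq> (\<lambda>_. 0)" "\<And>b. v b \<noteq> 0 \<Longrightarrow> rdeg m (fst b) \<le> (LEAST N. P N)"
    unfolding P_def by blast
  have vV: "v \<in> Vmod m n k" using v(1) submodD(1)[OF S] by blast
  have "fst b = rone" if vb: "v b \<noteq> 0" for b
  proof (rule ccontr)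
    assume "fst b \<noteq> rone"
    obtain g w where b: "b = (g, w)" by (cases b)
    obtain a where a: "a < m + n" "dcoef m a g \<noteq> (0::'a)"
      using ex_dcoef_nonzero[OF Vmod_valid(1)[OF vV vb]] \<open>fst b \<noteq> rone\<close> b by auto
    define v' where "v' = actv m n (vfield m rone a) v"
    have "v' \<in> S" unfolding v'_def
      by (rule submodD(6)[OF S v(1) valid_vfield[OF valid_rmon_rone a(1)]])
    moreover have "v' (dmon m a g, w) \<noteq> 0"
      unfolding v'_def actv_partial_apply[OF Vmod_fin_supp[OF vV] a(2)] using vb a b by simp
    then have "v' \<noteq> (\<lambda>_. 0)" by auto
    moreover have deg: "Suc (rdeg m (fst b')) \<le> (LEAST N. P N)" if "v' b' \<noteq> 0" for b'
      using that unfolding v'_def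
    proof (rule actv_partial_nonzeroE)
      fix h u assume *: "v (h, u) \<noteq> 0" "dcoef m a h \<noteq> (0::'a)" "b' = (dmon m a h, u)"
      have "finite (snd h)" using Vmod_valid(3)[OF vV *(1)] by simp
      from rdeg_dmon[OF this *(2)] show ?thesis using v(3)[OF *(1)] *(3) by simp
    qed
    ultimately have "P ((LEAST N. P N) - 1)" unfolding P_def by (intro bexI[of _ v']) fastforce+
    \<comment> \<open>\<open>deg\<close> also shows that the least bound is positive, so the
      subtraction is not truncated.\<close>
    moreover have "(LEAST N. P N) - 1 < (LEAST N. P N)"
      using deg[OF \<open>v' (dmon m a g, w) \<noteq> 0\<close>] by simp
    ultimately show False using not_less_Least by blast
  qed
  with vV have "v \<in> constants m n k" unfolding constants_def by blast
  then show ?thesis using that v by blast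
qed

lemma valid_om_count_eqI:
  assumes "valid_om m n k w" "valid_om m n l u" "\<And>c. c < m + n \<Longrightarrow> count (mset w) c = count (mset u) c"
  shows "w = u"
proof (rule sorted_eqI)
  show "sorted w" "sorted u" using assms by (simp_all add: valid_om_def)
  show "mset w = mset u"
  proof (rule multiset_eqI)
    fix c
    show "count (mset w) c = count (mset u) c"
    proof (cases "c < m + n")
      case False
      then have "c \<notin> set w" "c \<notin> set u" using assms by (auto simp: valid_om_def)
      then show ?thesis by (metis count_eq_zero_iff set_mset_mset)
    qed (rule assms(3))
  qed
qed

text \<open>The basis monomials of \<open>\<Omega>\<^sup>k(V)\<close> have pairwise different weights, so a constant
  vector of minimal support is a multiple of a single monomial.\<close>

lemma submod_has_monomial:
  fixes S :: "'a::field_char_0 vec set"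
  assumes S: "submod m n k S" and "v \<in> S" "v \<noteq> (\<lambda>_. 0)" "v \<in> constants m n k"
  shows "\<exists>w. valid_om m n k w \<and> single 1 (rone, w) \<in> S"
  using assms(2-)
proof (induction "card {b. v b \<noteq> 0}" arbitrary: v rule: less_induct)
  case less
  have vV: "v \<in> Vmod m n k" and r: "\<And>b. v b \<noteq> 0 \<Longrightarrow> fst b = rone"
    using less.prems(3) unfolding constants_def by blast+
  obtain b1 where b1: "v b1 \<noteq> 0" using less.prems(2) by (meson ext)
  obtain w1 where b1': "b1 = (rone, w1)" using r[OF b1] by (cases b1) auto
  have w1: "valid_om m n k w1" using Vmod_valid(2)[OF vV b1] b1' by simp
  show ?case
  proof (cases "\<exists>b2. v b2 \<noteq> 0 \<and> b2 \<noteq> b1")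
    case False
    then have "v = single (v b1) b1" by (intro ext) (metis single_def)
    then have "single 1 b1 \<in> S" using submod_single_scale[OF S, of "v b1" b1] less.prems b1 by simp
    then show ?thesis using w1 b1' by blast
  next
    case True
    then obtain b2 where b2: "v b2 \<noteq> 0" "b2 \<noteq> b1" by blast
    obtain w2 where b2': "b2 = (rone, w2)" using r[OF b2(1)] by (cases b2) auto
    have w2: "valid_om m n k w2" using Vmod_valid(2)[OF vV b2(1)] b2' by simp
    obtain c where c: "c < m + n" "count (mset w2) c \<noteq> count (mset w1) c"
      using valid_om_count_eqI[OF w2 w1] b2(2) b1' b2' by blast
    \<comment> \<open>A torus element shifted by its eigenvalue at \<open>w1\<close>: it removes
      \<open>b1\<close> from the support and keeps \<open>b2\<close>.\<close>
    define v' where "v' = (\<lambda>b. actv m n (vfield m (xvar m c) c) v b + (- of_nat (count (mset w1) c)) * v b)"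
    have v'_eq: "v' b = (of_nat (var_deg m c (fst b) + count (mset (snd b)) c) - of_nat (count (mset w1) c)) * v b" for b
      unfolding v'_def actv_euler[OF vV c(1)] by (simp add: algebra_simps)
    have "v' \<in> S" unfolding v'_def using less.prems(1)
      by (intro submodD(3)[OF S] submodD(4)[OF S] submodD(6)[OF S] valid_vfield valid_rmon_xvar c(1))
    moreover have "v' b2 \<noteq> 0" using b2 c(2) unfolding v'_eq b2' by simp
    then have "v' \<noteq> (\<lambda>_. 0)" by auto
    moreover have "v' \<in> constants m n k"
      using submodD(1)[OF S] \<open>v' \<in> S\<close> r by (auto simp: constants_def v'_eq)
    moreover have "card {b. v' b \<noteq> 0} < card {b. v b \<noteq> 0}"
    proof (rule psubset_card_mono)
      have "v' b1 = 0" unfolding v'_eq b1' by simp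
      then show "{b. v' b \<noteq> 0} \<subset> {b. v b \<noteq> 0}" using b1 by (auto simp: v'_eq)
    qed (rule Vmod_fin_supp[OF vV])
    ultimately show ?thesis using less.hyps by blast
  qed
qed

text \<open>On a constant form the derivation part is 0, so the field acts through the gl-element
  \<open>E_ca\<close> alone.\<close>

lemma actv_xvar_constant:
  fixes c a :: nat
  assumes "c < m + n" "om_ok m w"
  shows "actv m n (vfield m (xvar m c) a) (single 1 (rone, w))
    = single (sgn (((m \<le> c) \<noteq> (m \<le> a)) \<and> (opar m w \<noteq> (m \<le> a))) *
        (icoef m a w * ocoef m (remove1 a w) c) :: 'a::comm_ring_1) (rone, insort c (remove1 a w))"
proof
  fix b' :: bas
  obtain g' w' where b': "b' = (g', w')" by (cases b')
  show "actv m n (vfield m (xvar m c) a) (single 1 (rone, w)) b'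
    = single (sgn (((m \<le> c) \<noteq> (m \<le> a)) \<and> (opar m w \<noteq> (m \<le> a))) *
        (icoef m a w * ocoef m (remove1 a w) c) :: 'a) (rone, insort c (remove1 a w)) b'"
    unfolding actv_def lext_single b' actb_xvar[OF assms(1)] xi_eq_contraction_wedge[OF assms(2)]
    by (simp add: sgn_def) (auto simp: single_def)
qed

text \<open>A letter \<open>b\<close> in surplus over \<open>w'\<close> is exchanged for a missing
  letter \<open>a\<close> by means of \<open>E_ab\<close>; each exchange shrinks the multiset
  difference to \<open>w'\<close>, and its coefficient is nonzero in characteristic 0.\<close>

lemma submod_move_monomial:
  fixes S :: "'a::field_char_0 vec set"
  assumes S: "submod m n k S" and w': "valid_om m n k w'"
    and "valid_om m n k w" "single 1 (rone, w) \<in> S"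
  shows "single 1 (rone, w') \<in> S"
  using assms(3-)
proof (induction "size (mset w' - mset w)" arbitrary: w rule: less_induct)
  case less
  have ok: "om_ok m w" "om_ok m w'" and len: "size (mset w) = k" "size (mset w') = k"
    using less.prems w' by (simp_all add: valid_om_iff)
  show ?case
  proof (cases "w = w'")
    case True
    then show ?thesis using less.prems by simp
  next
    case False
    have "\<not> mset w' \<subseteq># mset w" "\<not> mset w \<subseteq># mset w'"
    proof -
      have "mset w \<noteq> mset w'" using False sorted_eqI ok om_ok_sorted by blast
      then show "\<not> mset w' \<subseteq># mset w" "\<not> mset w \<subseteq># mset w'"
        using len by (metis mset_subset_size nless_le subset_mset.le_imp_less_or_eq)+
    qed
    then obtain a b where a: "count (mset w) a < count (mset w') a" and b: "count (mset w') b < count (mset w) b"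
      by (meson mset_subset_eqI not_le)
    have aw: "a \<in> set w'" and bw: "b \<in> set w"
      using a b by (metis count_eq_zero_iff not_less_zero set_mset_mset)+
    have "a \<noteq> b" using a b by auto
    have am: "a < m + n" and bm: "b < m + n" using aw bw w' less.prems(1) by (auto simp: valid_om_def)
    \<comment> \<open>An even letter occurs at most once in \<open>w'\<close> and less often in
      \<open>w\<close>, so wedging with it does not give 0.\<close>
    have na: "a \<notin> set (remove1 b w)" if "a < m"
    proof -
      have "count (mset w') a \<le> 1" using om_ok_count[OF ok(2) that] by simp
      then have "a \<notin> set w" using a by (metis count_eq_zero_iff less_one order_less_le_trans set_mset_mset)
      then show ?thesis using set_remove1_subset by fastforce
    qed
    define w1 where "w1 = insort a (remove1 b w)"
    have "valid_om m n k w1"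
    proof -
      have "k \<noteq> 0" using len bw by auto
      then show ?thesis unfolding w1_def
        using valid_om_insort[OF valid_om_remove1[OF less.prems(1) bw] am] na by auto
    qed
    moreover have "single 1 (rone, w1) \<in> S"
    proof (rule submod_single_scale[OF S])
      let ?c = "sgn (((m \<le> a) \<noteq> (m \<le> b)) \<and> (opar m w \<noteq> (m \<le> b))) *
        (icoef m b w * ocoef m (remove1 b w) a) :: 'a"
      show "single ?c (rone, w1) \<in> S"
        using submodD(6)[OF S less.prems(2) valid_vfield[OF valid_rmon_xvar[OF am] bm]]
        unfolding actv_xvar_constant[OF am ok(1)] w1_def .
      show "?c \<noteq> 0" using bw na by (simp add: icoef_def ocoef_def)
    qed
    moreover have "size (mset w' - mset w1) < size (mset w' - mset w)"
    proof -
      have "mset w' - mset w1 = (mset w' - mset w) - {#a#}"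
        using b \<open>a \<noteq> b\<close> by (intro multiset_eqI) (auto simp: w1_def)
      moreover have "a \<in># mset w' - mset w" using a by (simp add: in_diff_count)
      ultimately show ?thesis by (simp only: size_Diff1_less)
    qed
    ultimately show ?thesis using less.hyps by blast
  qed
qed

text \<open>Differentiation yields a constant form, weight separation a single monomial, and the
  gl-action every other monomial; these span the constants.\<close>

lemma constants_subset_submod:
  fixes S :: "'a::field_char_0 vec set"
  assumes S: "submod m n k S" and "S \<noteq> {\<lambda>_. 0}"
  shows "constants m n k \<subseteq> S"
proof
  fix v :: "'a vec" assume v: "v \<in> constants m n k"
  obtain u where "u \<in> S" "u \<noteq> (\<lambda>_. 0)" using assms submodD(2)[OF S] by blast
  then obtain u' where "u' \<in> S" "u' \<noteq> (\<lambda>_. 0)" "u' \<in> constants m n k"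
    by (rule submod_has_constant[OF S])
  then obtain w where w: "valid_om m n k w" "single 1 (rone, w) \<in> S"
    using submod_has_monomial[OF S] by blast
  have vV: "v \<in> Vmod m n k" using v by (simp add: constants_def)
  have "lext (single 1) v \<in> S"
  proof (rule submod_lext[OF S Vmod_fin_supp[OF vV]])
    fix b assume b: "v b \<noteq> 0"
    then obtain w' where "b = (rone, w')" using v by (cases b) (auto simp: constants_def)
    then show "single 1 b \<in> S"
      using submod_move_monomial[OF S _ w] Vmod_valid(2)[OF vV b] by simp
  qed
  then show "v \<in> S" by (simp add: lext_single_self Vmod_fin_supp[OF vV])
qed

section \<open>Image of the differential as a generated submodule\<close>

lemma dd_constant: "v \<in> constants m n k \<Longrightarrow> dd m n v = (\<lambda>_. 0)" for v :: "'a::comm_ring_1 vec"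
proof
  fix b' assume v: "v \<in> constants m n k"
  have "dd m n v b' = lext (\<lambda>_ _. 0) v b'"
    unfolding dd_def
  proof (rule lext_cong)
    fix b assume "v b \<noteq> 0"
    then obtain w where "b = (rone, w)" using v by (cases b) (auto simp: constants_def)
    then show "ddb m n b b' = (0::'a)" by (simp add: ddb_eq)
  qed
  then show "dd m n v b' = 0" by (simp add: lext_def)
qed

lemma submod_Vmod: "submod m n k (Vmod m n k :: 'a::field_char_0 vec set)"
  unfolding submod_def
  by (intro conjI ballI allI impI subset_refl Vmod_zero Vmod_add Vmod_scale evpart_in_Vmod actv_in_Vmod)

text \<open>\<open>d\<close> is linear, even and commutes with all vector fields, so each closure
  property passes to the image.\<close>

lemma submod_image_dd:
  fixes S :: "'a::field_char_0 vec set"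
  assumes S: "submod m n k S"
  shows "submod m n (Suc k) (dd m n ` S)"
proof -
  note V = subsetD[OF submodD(1)[OF S]]
  show ?thesis
    unfolding submod_def
  proof (intro conjI ballI allI impI)
    show "dd m n ` S \<subseteq> Vmod m n (Suc k)" using V dd_in_Vmod by blast
    show "(\<lambda>_. 0) \<in> dd m n ` S" using imageI[OF submodD(2)[OF S], of "dd m n"] by simp
  next
    fix u v assume "u \<in> dd m n ` S" "v \<in> dd m n ` S"
    then obtain u' v' where uv: "u' \<in> S" "v' \<in> S" "u = dd m n u'" "v = dd m n v'" by blast
    show "(\<lambda>b. u b + v b) \<in> dd m n ` S"
      using imageI[OF submodD(3)[OF S uv(1,2)], of "dd m n"] by (simp add: dd_add[OF V V] uv)
  next
    fix c u assume "u \<in> dd m n ` S"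
    then obtain u' where u: "u' \<in> S" "u = dd m n u'" by blast
    show "(\<lambda>b. c * u b) \<in> dd m n ` S"
      using imageI[OF submodD(4)[OF S u(1)], of "dd m n" c] by (simp add: dd_scale[OF V] u)
  next
    fix u assume "u \<in> dd m n ` S"
    then obtain u' where u: "u' \<in> S" "u = dd m n u'" by blast
    show "evpart m u \<in> dd m n ` S"
      using imageI[OF submodD(5)[OF S u(1)], of "dd m n"] by (simp add: dd_evpart[OF V] u)
  next
    fix X u assume "u \<in> dd m n ` S" and X: "valid_vf m n X"
    then obtain u' where u: "u' \<in> S" "u = dd m n u'" by blast
    show "actv m n X u \<in> dd m n ` S"
      using imageI[OF submodD(6)[OF S u(1) X], of "dd m n"] by (simp add: dd_actv[OF V X] u)
  qed
qed

lemma left_inverse_mult: "c \<noteq> 0 \<Longrightarrow> inverse c * (c * x) = x" for c :: "'a::field"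
  by simp

text \<open>For a constant form \<open>c\<close> the Cartan formula reads \<open>X c = d \<iota>\<^sub>X c\<close>; with
  \<open>X = f \<partial>\<^sub>m\<close> and \<open>c = w \<and> e\<^sub>m\<close> (the first odd index) the right-hand side is a nonzero multiple of \<open>d (f \<otimes> w)\<close>.\<close>

lemma image_dd_subset_submod:
  fixes S :: "'a::field_char_0 vec set"
  assumes n: "1 \<le> n" and S: "submod m n (Suc k) S" and C: "constants m n (Suc k) \<subseteq> S"
  shows "dd m n ` Vmod m n k \<subseteq> S"
proof -
  have basis: "ddb m n (f, w) \<in> S" if f: "valid_rmon m n f" and w: "valid_om m n k w" for f w
  proof -
    have mn: "m < m + n" using n by simp
    \<comment> \<open>As \<open>m\<close> is an odd index, inserting it never kills a monomial, and
      its multiplicity afterwards is a successor, hence invertible in the field.\<close>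
    let ?v = "single 1 (rone, insort m w) :: 'a vec"
    let ?c = "sgn (m \<le> m \<and> rpar rone = opar m (insort m w)) * mcoef f rone * icoef m m (insort m w) :: 'a"
    have "valid_om m n (Suc k) (insort m w)" using valid_om_insort[OF w mn] by simp
    then have v: "?v \<in> Vmod m n (Suc k)" by (intro Vmod_single) (simp add: valid_rmon_rone)
    then have vc: "?v \<in> constants m n (Suc k)" by (auto simp: constants_def single_def)
    have "iota m f m ?v = single ?c (f, w)"
      by (auto simp: iota_def lext_single iotab_def fun_eq_iff)
    then have "actv m n (vfield m f m) ?v = (\<lambda>b. ?c * ddb m n (f, w) b)"
      unfolding cartan[OF v f mn] dd_constant[OF vc] by (simp add: dd_def lext_single)
    moreover have "actv m n (vfield m f m) ?v \<in> S"
      using submodD(6)[OF S subsetD[OF C vc] valid_vfield[OF f mn]] .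
    ultimately have "(\<lambda>b. inverse ?c * (?c * ddb m n (f, w) b)) \<in> S"
      using submodD(4)[OF S] by metis
    moreover have "?c \<noteq> 0"
    proof -
      have "of_nat (Suc (count (mset w) m)) \<noteq> (0::'a)" by (rule of_nat_neq_0)
      then show ?thesis by (simp add: icoef_def)
    qed
    then have "inverse ?c * (?c * x) = x" for x by (rule left_inverse_mult)
    then have "(\<lambda>b. inverse ?c * (?c * ddb m n (f, w) b)) = ddb m n (f, w)" by (rule ext)
    ultimately show ?thesis by simp
  qed
  show ?thesis
  proof
    fix u assume "u \<in> dd m n ` (Vmod m n k :: 'a vec set)"
    then obtain v :: "'a vec" where v: "v \<in> Vmod m n k" "u = dd m n v" by blast
    show "u \<in> S" unfolding v(2) dd_def
    proof (rule submod_lext[OF S Vmod_fin_supp[OF v(1)]])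
      fix b assume "v b \<noteq> 0"
      then show "ddb m n b \<in> S" using basis[of "fst b" "snd b"] Vmod_valid[OF v(1)] by simp
    qed
  qed
qed

text \<open>Constant forms are closed, hence exact.\<close>

lemma constants_subset_image_dd:
  "constants m n (Suc k) \<subseteq> dd m n ` (Vmod m n k :: 'a::field_char_0 vec set)"
  unfolding image_dd_eq_kernel using dd_constant by (fastforce simp only: constants_def)

text \<open>The image is a submodule containing the constants, and every submodule that contains
  them contains the image.\<close>

lemma Lmod_eq_image_dd:
  assumes "1 \<le> n"
  shows "Lmod m n (Suc k) = dd m n ` (Vmod m n k :: 'a::field_char_0 vec set)"
proof
  show "Lmod m n (Suc k) \<subseteq> dd m n ` (Vmod m n k :: 'a vec set)"
    unfolding Lmod_eq using submod_image_dd[OF submod_Vmod] constants_subset_image_dd by blast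
  show "dd m n ` (Vmod m n k :: 'a vec set) \<subseteq> Lmod m n (Suc k)"
    unfolding Lmod_eq using image_dd_subset_submod[OF assms] by blast
qed

text \<open>Powers of an odd basis vector are nonzero in every degree, so no module of the complex
  is zero.\<close>

lemma constant_replicate:
  assumes "1 \<le> n"
  shows "single (1::'a::field_char_0) (rone, replicate k m) \<in> constants m n k"
proof -
  have "valid_om m n k (replicate k m)" using assms by (auto simp: valid_om_def)
  then show ?thesis
    by (auto simp: constants_def valid_rmon_rone intro!: Vmod_single) (auto simp: single_def split: if_splits)
qed

lemma single_one_nonzero: "single (1::'a::field_char_0) b \<noteq> (\<lambda>_. 0)"
  by (metis single_def zero_neq_one)

text \<open>A nonzero submodule contains the constants, and these generate the whole image.\<close>

lemma simple_image_dd: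
  assumes n: "1 \<le> n"
  shows "simple_sub m n (Suc k) (dd m n ` (Vmod m n k :: 'a::field_char_0 vec set))"
  unfolding simple_sub_def
proof (intro conjI allI impI)
  show "submod m n (Suc k) (dd m n ` (Vmod m n k :: 'a vec set))"
    by (rule submod_image_dd[OF submod_Vmod])
  let ?c = "single 1 (rone, replicate (Suc k) m) :: 'a vec"
  have "?c \<in> dd m n ` (Vmod m n k :: 'a vec set)"
    by (rule subsetD[OF constants_subset_image_dd constant_replicate[OF n]])
  moreover have "?c \<notin> {\<lambda>_. 0}" using single_one_nonzero by simp
  ultimately show "dd m n ` (Vmod m n k :: 'a vec set) \<noteq> {\<lambda>_. 0}" by metis
next
  fix T :: "'a vec set" assume T: "submod m n (Suc k) T \<and> T \<subseteq> dd m n ` Vmod m n k"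
  then show "T = {\<lambda>_. 0} \<or> T = dd m n ` Vmod m n k"
    using image_dd_subset_submod[OF n, of m k T] constants_subset_submod[of m n "Suc k" T] by blast
qed

text \<open>Otherwise \<open>d\<close> would vanish on all forms of degree \<open>Suc k\<close>,
  whereas its image contains nonzero constant forms one degree higher.\<close>

lemma image_dd_neq_Vmod:
  assumes n: "1 \<le> n"
  shows "dd m n ` (Vmod m n k :: 'a::field_char_0 vec set) \<noteq> Vmod m n (Suc k)"
proof
  let ?V = "Vmod m n (Suc k) :: 'a vec set"
  assume "dd m n ` (Vmod m n k :: 'a vec set) = ?V"
  then have *: "dd m n v = (\<lambda>_. 0)" if "v \<in> ?V" for v
    using that unfolding image_dd_eq_kernel[of m n k] by blast
  obtain v :: "'a vec" where "v \<in> ?V" "dd m n v = single 1 (rone, replicate (Suc (Suc k)) m)"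
    using subsetD[OF constants_subset_image_dd constant_replicate[OF n, of "Suc (Suc k)" m, where 'a='a]]
    by (metis imageE)
  with * show False using single_one_nonzero by metis
qed

text \<open>A nonzero \<open>T\<close> contains the image, which is the kernel of the next
  \<open>d\<close>. By simplicity that \<open>d\<close> maps \<open>T\<close> to 0 or onto its whole
  image, so \<open>T\<close> is the kernel or, containing the kernel, the whole module.\<close>

lemma submod_Vmod_cases:
  fixes T :: "'a::field_char_0 vec set"
  assumes n: "1 \<le> n" and T: "submod m n (Suc k) T"
  shows "T = {\<lambda>_. 0} \<or> T = dd m n ` Vmod m n k \<or> T = Vmod m n (Suc k)"
proof (cases "T = {\<lambda>_. 0}")
  case False
  have LT: "dd m n ` Vmod m n k \<subseteq> T"
    by (rule image_dd_subset_submod[OF n T constants_subset_submod[OF T False]])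
  note TV = submodD(1)[OF T]
  have "submod m n (Suc (Suc k)) (dd m n ` T)" by (rule submod_image_dd[OF T])
  moreover have "dd m n ` T \<subseteq> dd m n ` Vmod m n (Suc k)" using TV by blast
  ultimately consider "dd m n ` T = {\<lambda>_. 0}" | "dd m n ` T = dd m n ` Vmod m n (Suc k)"
    using simple_image_dd[OF n, of m "Suc k", where 'a='a] unfolding simple_sub_def by blast
  then show ?thesis
  proof cases
    case 1
    then have "T \<subseteq> dd m n ` Vmod m n k" unfolding image_dd_eq_kernel using TV by blast
    then show ?thesis using LT by blast
  next
    case 2
    have "v \<in> T" if v: "v \<in> Vmod m n (Suc k)" for v
    proof -
      obtain t where t: "t \<in> T" "dd m n v = dd m n t" using 2 v by blast
      have tV: "t \<in> Vmod m n (Suc k)" using TV t by blast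
      let ?d = "\<lambda>b. v b + - 1 * t b"
      have s: "(\<lambda>b. - 1 * t b) \<in> Vmod m n (Suc k)" by (rule Vmod_scale[OF tV])
      have "dd m n ?d = (\<lambda>_. 0)"
        unfolding dd_add[OF v s] dd_scale[OF tV] t(2) by simp
      then have "?d \<in> dd m n ` Vmod m n k"
        unfolding image_dd_eq_kernel using Vmod_add[OF v s] by simp
      with LT have "?d \<in> T" by blast
      from submodD(3)[OF T this t(1)] show ?thesis by simp
    qed
    then show ?thesis using TV by blast
  qed
qed simp

section \<open>Composition factors\<close>

lemma modhom_dd: "modhom m n (Vmod m n k) (dd m n :: 'a::field_char_0 vec \<Rightarrow> 'a vec)"
  unfolding modhom_def
  by (intro conjI ballI allI impI) (rule dd_add dd_scale dd_evpart dd_actv; assumption)+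

lemma mod_iso_refl: "mod_iso m n M M"
  unfolding mod_iso_def factor_iso_def by (rule exI[of _ "\<lambda>u. u"]) (auto simp: modhom_def)

text \<open>First isomorphism theorem for \<open>d\<close>, with exactness identifying the
  kernel.\<close>

lemma factor_iso_dd:
  "factor_iso m n (dd m n ` (Vmod m n k :: 'a::field_char_0 vec set)) (Vmod m n (Suc k)) (dd m n ` Vmod m n (Suc k))"
  unfolding factor_iso_def
  by (intro exI[of _ "dd m n"] conjI modhom_dd refl ballI) (simp add: image_dd_eq_kernel)

text \<open>An isomorphism would send the constant \<open>e_m^k\<close> to a nonzero vector killed
  by all partial derivatives, hence constant, of the same torus weight. The weight determines the
  monomial, but its length would have to be both \<open>k\<close> and \<open>Suc k\<close>.\<close>

lemma not_mod_iso_Lmod: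
  assumes n: "1 \<le> n"
  shows "\<not> mod_iso m n (Lmod m n k :: 'a::field_char_0 vec set) (Lmod m n (Suc k))"
proof
  assume "mod_iso m n (Lmod m n k :: 'a vec set) (Lmod m n (Suc k))"
  then obtain \<phi> :: "'a vec \<Rightarrow> 'a vec" where hom: "modhom m n (Lmod m n k) \<phi>" and
    im: "\<phi> ` Lmod m n k = Lmod m n (Suc k)" and ker: "\<And>u. u \<in> Lmod m n k \<Longrightarrow> \<phi> u = (\<lambda>_. 0) \<longleftrightarrow> u \<in> {\<lambda>_. 0}"
    unfolding mod_iso_def factor_iso_def by blast
  have scale: "\<And>c u. u \<in> Lmod m n k \<Longrightarrow> \<phi> (\<lambda>b. c * u b) = (\<lambda>b. c * \<phi> u b)"
    and act: "\<And>X u. u \<in> Lmod m n k \<Longrightarrow> valid_vf m n X \<Longrightarrow> \<phi> (actv m n X u) = actv m n X (\<phi> u)"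
    using hom unfolding modhom_def by blast+
  define w where "w = replicate k m"
  define v where "v = (single 1 (rone, w) :: 'a vec)"
  have vc: "v \<in> constants m n k" unfolding v_def w_def by (rule constant_replicate[OF n])
  then have vL: "v \<in> Lmod m n k" unfolding Lmod_eq by blast
  have vV: "v \<in> Vmod m n k" using vc by (simp add: constants_def)
  define u where "u = \<phi> v"
  have "u \<noteq> (\<lambda>_. 0)" unfolding u_def using ker[OF vL] single_one_nonzero by (simp add: v_def)
  have "u \<in> Lmod m n (Suc k)" unfolding u_def using im vL by blast
  then have uV: "u \<in> Vmod m n (Suc k)"
    unfolding Lmod_eq_image_dd[OF n] image_dd_eq_kernel by blast
  obtain b where b: "u b \<noteq> 0" using \<open>u \<noteq> _\<close> by (meson ext)
  obtain g x where gx: "b = (g, x)" by (cases b)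
  have "g = rone"
  proof (rule ccontr)
    assume "g \<noteq> rone"
    then obtain a where a: "a < m + n" "dcoef m a g \<noteq> (0::'a)"
      using ex_dcoef_nonzero[of m n g] Vmod_valid(1)[OF uV b] gx by auto
    let ?X = "vfield m rone a"
    \<comment> \<open>Vanishing is written as multiplication by 0, so that \<open>scale\<close>
      carries it through \<open>\<phi>\<close>.\<close>
    have "actv m n ?X v = (\<lambda>b. 0 * v b)"
      by (auto simp: v_def actv_def lext_single actb_partial)
    then have "actv m n ?X u = (\<lambda>b. 0 * u b)"
      using act[OF vL valid_vfield[OF valid_rmon_rone a(1)]] scale[OF vL, of 0] by (simp add: u_def)
    then show False
      using actv_partial_apply[OF Vmod_fin_supp[OF uV] a(2), of n x] a(2) b gx by simp
  qed
  have "count (mset x) c = count (mset w) c" if c: "c < m + n" for c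
  proof -
    let ?X = "vfield m (xvar m c) c"
    have "actv m n ?X v = (\<lambda>b. of_nat (count (mset w) c) * v b)"
      unfolding actv_euler[OF vV c] by (auto simp: v_def single_def)
    then have "actv m n ?X u = (\<lambda>b. of_nat (count (mset w) c) * u b)"
      using act[OF vL valid_vfield[OF valid_rmon_xvar[OF c] c]] scale[OF vL] by (simp add: u_def)
    from fun_cong[OF this, of b] show ?thesis
      unfolding actv_euler[OF uV c] using b gx \<open>g = rone\<close> by simp
  qed
  moreover have "valid_om m n (Suc k) x" using Vmod_valid(2)[OF uV b] gx by simp
  moreover have "valid_om m n k w" unfolding w_def using n by (auto simp: valid_om_def)
  ultimately have "x = w" by (intro valid_om_count_eqI)
  then show False using \<open>valid_om m n (Suc k) x\<close> \<open>valid_om m n k w\<close> by (simp add: valid_om_def)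
qed

text \<open>The only submodules are 0, the image and the whole module, and they form a chain; a
  strict series without gaps must pass through all three.\<close>

lemma comp_series_eq:
  fixes Ms :: "'a::field_char_0 vec set list"
  assumes n: "1 \<le> n" and Ms: "comp_series m n (Suc k) Ms"
  shows "Ms = [{\<lambda>_. 0}, dd m n ` Vmod m n k, Vmod m n (Suc k)]"
proof -
  let ?L = "dd m n ` (Vmod m n k :: 'a vec set)" and ?V = "Vmod m n (Suc k) :: 'a vec set"
  have ne: "Ms \<noteq> []" and h: "hd Ms = {\<lambda>_. 0}" and l: "last Ms = ?V"
    and sub: "\<And>i. i < length Ms \<Longrightarrow> submod m n (Suc k) (Ms ! i)"
    and less: "\<And>i. Suc i < length Ms \<Longrightarrow> Ms ! i \<subset> Ms ! Suc i"
    and max: "\<And>i T. Suc i < length Ms \<Longrightarrow> submod m n (Suc k) T \<Longrightarrow> Ms ! i \<subseteq> T \<Longrightarrow> T \<subseteq> Ms ! Suc i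
      \<Longrightarrow> T = Ms ! i \<or> T = Ms ! Suc i"
    using Ms unfolding comp_series_def by blast+
  have L: "submod m n (Suc k) ?L" and L0: "?L \<noteq> {\<lambda>_. 0}"
    using simple_image_dd[OF n] unfolding simple_sub_def by blast+
  have LV: "?L \<subseteq> ?V" using submodD(1)[OF L] .
  have LneV: "?L \<noteq> ?V" by (rule image_dd_neq_Vmod[OF n])
  have sub0: "{\<lambda>_. 0} \<subseteq> ?L" using submodD(2)[OF L] by blast
  note cases = submod_Vmod_cases[OF n sub]
  obtain M1 Ms1 where M1: "Ms = M1 # Ms1" using ne by (cases Ms) auto
  obtain M2 Ms2 where M2: "Ms1 = M2 # Ms2"
    using h l M1 L0 LV sub0 by (cases Ms1) auto
  have m1: "M1 = {\<lambda>_. 0}" using h M1 by simp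
  have "M1 \<subset> M2" using less[of 0] M1 M2 by simp
  \<comment> \<open>Otherwise the image would lie strictly between the first two members of the
    series.\<close>
  have "M2 \<noteq> ?V"
  proof
    assume "M2 = ?V"
    then have "?L = M1 \<or> ?L = ?V" using max[of 0 ?L] M1 M2 m1 sub0 LV L by simp
    then show False using L0 LneV m1 by simp
  qed
  then have m2: "M2 = ?L" using cases[of 1] M1 M2 m1 \<open>M1 \<subset> M2\<close> by auto
  obtain M3 Ms3 where M3: "Ms2 = M3 # Ms3" using l M1 M2 m2 LneV by (cases Ms2) auto
  have "M2 \<subset> M3" using less[of 1] M1 M2 M3 by simp
  then have m3: "M3 = ?V" using cases[of 2] M1 M2 M3 m2 sub0 by auto
  have "Ms3 = []"
  proof (cases Ms3)
    case (Cons M4 Ms4)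
    then have "M3 \<subset> M4" using less[of 2] M1 M2 M3 by simp
    moreover have "M4 \<subseteq> ?V" using submodD(1)[OF sub[of 3]] M1 M2 M3 Cons by simp
    ultimately show ?thesis using m3 by blast
  qed simp
  then show ?thesis using M1 M2 M3 m1 m2 m3 by simp
qed

lemma comp_series_Vmod:
  assumes n: "1 \<le> n"
  shows "comp_series m n (Suc k) [{\<lambda>_. 0}, dd m n ` (Vmod m n k :: 'a::field_char_0 vec set), Vmod m n (Suc k)]"
proof -
  let ?L = "dd m n ` (Vmod m n k :: 'a vec set)" and ?V = "Vmod m n (Suc k) :: 'a vec set"
  have L: "submod m n (Suc k) ?L" and L0: "?L \<noteq> {\<lambda>_. 0}"
    using simple_image_dd[OF n] unfolding simple_sub_def by blast+
  have LV: "?L \<subseteq> ?V" using submodD(1)[OF L] .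
  have sub0: "{\<lambda>_. 0} \<subseteq> ?L" using submodD(2)[OF L] by blast
  have LneV: "?L \<noteq> ?V" by (rule image_dd_neq_Vmod[OF n])
  have p: "{\<lambda>_. 0} \<subset> ?L" "?L \<subset> ?V" using sub0 L0 LV LneV by blast+
  have zero: "submod m n (Suc k) {\<lambda>_. 0 :: 'a}"
    by (auto simp: submod_def Vmod_zero evpart_def actv_def)
  show ?thesis
    unfolding comp_series_def
  proof (intro conjI allI impI; (elim conjE)?)
    fix i assume "i < length [{\<lambda>_. 0}, ?L, ?V]"
    then have "i = 0 \<or> i = 1 \<or> i = 2" by auto
    then show "submod m n (Suc k) ([{\<lambda>_. 0}, ?L, ?V] ! i)" using zero L submod_Vmod by auto
  next
    fix i assume "Suc i < length [{\<lambda>_. 0}, ?L, ?V]"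
    then have "i = 0 \<or> i = 1" by auto
    then show "[{\<lambda>_. 0}, ?L, ?V] ! i \<subset> [{\<lambda>_. 0}, ?L, ?V] ! Suc i"
      by (elim disjE) (simp_all only: p nth_Cons_0 nth_Cons_Suc One_nat_def)
  next
    fix i T assume i: "Suc i < length [{\<lambda>_. 0}, ?L, ?V]" and T: "submod m n (Suc k) T"
      and "[{\<lambda>_. 0}, ?L, ?V] ! i \<subseteq> T" "T \<subseteq> [{\<lambda>_. 0}, ?L, ?V] ! Suc i"
    moreover have "i = 0 \<or> i = 1" using i by auto
    ultimately show "T = [{\<lambda>_. 0}, ?L, ?V] ! i \<or> T = [{\<lambda>_. 0}, ?L, ?V] ! Suc i"
      using submod_Vmod_cases[OF n T] p
      by (elim disjE) (simp_all only: nth_Cons_0 nth_Cons_Suc One_nat_def, blast+)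
  qed simp_all
qed

theorem theorem4p3:
  fixes m n :: nat
  assumes "1 \<le> m" and "1 \<le> n"
    and "alg_closed_ty TYPE('a::field_char_0)"
  shows
   "(\<forall>k. dd m n ` (Vmod m n k :: 'a vec set) = {v \<in> Vmod m n (Suc k). dd m n v = (\<lambda>_. 0)}
        \<and> simple_sub m n (Suc k) (dd m n ` (Vmod m n k :: 'a vec set))
        \<and> mod_iso m n (dd m n ` (Vmod m n k :: 'a vec set)) (Lmod m n (Suc k)))
  \<and> (\<forall>k\<ge>1.
        comp_series m n k [{\<lambda>_. 0}, dd m n ` (Vmod m n (k - 1) :: 'a vec set), Vmod m n k]
      \<and> mod_iso m n (dd m n ` (Vmod m n (k - 1) :: 'a vec set)) (Lmod m n k)
      \<and> factor_iso m n (dd m n ` (Vmod m n (k - 1) :: 'a vec set)) (Vmod m n k) (Lmod m n (Suc k))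
      \<and> factor_iso m n (dd m n ` (Vmod m n (k - 1) :: 'a vec set)) (Vmod m n k)
          (dd m n ` (Vmod m n k :: 'a vec set))
      \<and> \<not> mod_iso m n (Lmod m n k :: 'a vec set) (Lmod m n (Suc k))
      \<and> (\<forall>Ms :: 'a vec set list. comp_series m n k Ms \<longrightarrow> length Ms = 3 \<and>
           ((factor_iso m n (Ms ! 0) (Ms ! 1) (Lmod m n k)
              \<and> factor_iso m n (Ms ! 1) (Ms ! 2) (Lmod m n (Suc k)))
          \<or> (factor_iso m n (Ms ! 0) (Ms ! 1) (Lmod m n (Suc k))
              \<and> factor_iso m n (Ms ! 1) (Ms ! 2) (Lmod m n k)))))"
proof (rule conjI; intro allI impI)
  note n = assms(2)
  fix k
  show "dd m n ` (Vmod m n k :: 'a vec set) = {v \<in> Vmod m n (Suc k). dd m n v = (\<lambda>_. 0)}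
        \<and> simple_sub m n (Suc k) (dd m n ` (Vmod m n k :: 'a vec set))
        \<and> mod_iso m n (dd m n ` (Vmod m n k :: 'a vec set)) (Lmod m n (Suc k))"
    using image_dd_eq_kernel simple_image_dd[OF n] mod_iso_refl
    unfolding Lmod_eq_image_dd[OF n] by blast
next
  note n = assms(2)
  fix k :: nat assume "1 \<le> k"
  then obtain l where k: "k = Suc l" by (cases k) auto
  have [simp]: "k - 1 = l" using k by simp
  note Lk = Lmod_eq_image_dd[OF n, of m l, where 'a='a, folded k]
  have quot: "factor_iso m n (dd m n ` (Vmod m n l :: 'a vec set)) (Vmod m n k) (Lmod m n (Suc k))"
    unfolding Lmod_eq_image_dd[OF n] k by (rule factor_iso_dd)
  have iso: "mod_iso m n (dd m n ` (Vmod m n l :: 'a vec set)) (Lmod m n k)"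
    unfolding Lk by (rule mod_iso_refl)
  \<comment> \<open>The composition series is unique, so of the two admissible orders of the factors
    the first always occurs.\<close>
  have "length Ms = 3 \<and> factor_iso m n (Ms ! 0) (Ms ! 1) (Lmod m n k)
      \<and> factor_iso m n (Ms ! 1) (Ms ! 2) (Lmod m n (Suc k))"
    if "comp_series m n k Ms" for Ms :: "'a vec set list"
    using comp_series_eq[OF n that[unfolded k]] iso quot by (simp add: mod_iso_def k)
  then show "comp_series m n k [{\<lambda>_. 0}, dd m n ` (Vmod m n (k - 1) :: 'a vec set), Vmod m n k]
      \<and> mod_iso m n (dd m n ` (Vmod m n (k - 1) :: 'a vec set)) (Lmod m n k)
      \<and> factor_iso m n (dd m n ` (Vmod m n (k - 1) :: 'a vec set)) (Vmod m n k) (Lmod m n (Suc k))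
      \<and> factor_iso m n (dd m n ` (Vmod m n (k - 1) :: 'a vec set)) (Vmod m n k)
          (dd m n ` (Vmod m n k :: 'a vec set))
      \<and> \<not> mod_iso m n (Lmod m n k :: 'a vec set) (Lmod m n (Suc k))
      \<and> (\<forall>Ms :: 'a vec set list. comp_series m n k Ms \<longrightarrow> length Ms = 3 \<and>
           ((factor_iso m n (Ms ! 0) (Ms ! 1) (Lmod m n k)
              \<and> factor_iso m n (Ms ! 1) (Ms ! 2) (Lmod m n (Suc k)))
          \<or> (factor_iso m n (Ms ! 0) (Ms ! 1) (Lmod m n (Suc k))
              \<and> factor_iso m n (Ms ! 1) (Ms ! 2) (Lmod m n k))))"
    using comp_series_Vmod[OF n, of m l, where 'a='a] iso quot factor_iso_dd[of m n l, where 'a='a]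
      not_mod_iso_Lmod[OF n, of m k, where 'a='a]
    by (simp add: k)
qed

end
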